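(* Let $\mathcal H$ be a finite-dimensional complex Hilbert space, $H=H^\dagger$ a Hamiltonian on $\mathcal H$, and $|\psi\rangle\in\mathcal H$ a unit vector that is not an eigenvector of $H$; put $|\psi_t\rangle=e^{-itH}|\psi\rangle$, $t\in\mathbb R$. Let $0<\epsilon\le 1$ and $c>0$, and for every $N\in\mathbb N$ let $\mathcal P_{\mathrm{yes},N}$ be a replication process for the states $\{|\psi_t\rangle\}_{t\in\mathbb R}$ transforming $N$ input copies into $M=M(N)$ approximate copies, where $M(N)\ge c\,N^{1+\epsilon}$. Let $p_{\mathrm{yes},N}$ be the success probability of $\mathcal P_{\mathrm{yes},N}$. If $$\liminf_{N\to\infty}\ \frac{p_{\mathrm{yes},N}}{e^{-N^{\delta}}}>0\qquad\text{for some }\delta<\epsilon,$$ then the fidelity of the replicas vanishes asymptotically: $\lim_{N\to\infty}F[\mathcal P_{\mathrm{yes},N}]=0$.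
   Context: A (probabilistic) replication process from $N$ to $M$ copies is a completely positive, trace non-increasing linear map $\mathcal P_{\mathrm{yes}}$ from operators on $\mathcal H^{\otimes N}$ to operators on $\mathcal H^{\otimes M}$ (the "successful" branch of a quantum instrument $\{\mathcal P_{\mathrm{yes}},\mathcal P_{\mathrm{no}}\}$). On input $|\psi_t\rangle^{\otimes N}$ its success probability is $p_{\mathrm{yes}}(t)=\mathrm{Tr}\big[\mathcal P_{\mathrm{yes}}\big((|\psi_t\rangle\langle\psi_t|)^{\otimes N}\big)\big]$, and the success probability of the process is $p_{\mathrm{yes}}=\inf_{t}p_{\mathrm{yes}}(t)$. (For a covariant process, i.e. one with $U_t^{\otimes M}\mathcal P_{\mathrm{yes}}(\rho)U_t^{\otimes M\dagger}=\mathcal P_{\mathrm{yes}}(U_t^{\otimes N}\rho\, U_t^{\otimes N\dagger})$ for all $t,\rho$, with $U_t=e^{-itH}$, the number $p_{\mathrm{yes}}(t)$ does not depend on $t$.) Its (worst-case, global) fidelity is $$F[\mathcal P_{\mathrm{yes}}]=\inf_{t}\frac{\langle\psi_t|^{\otimes M}\,\mathcal P_{\mathrm{yes}}\big((|\psi_t\rangle\langle\psi_t|)^{\otimes N}\big)\,|\psi_t\rangle^{\otimes M}}{\mathrm{Tr}\big[\mathcal P_{\mathrm{yes}}\big((|\psi_t\rangle\langle\psi_t|)^{\otimes N}\big)\big]},$$ the infimum being over those $t\in\mathbb R$ for which the denominator is nonzero. *)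

theory Defs
  imports
    "Jordan_Normal_Form.Char_Poly"
    "Jordan_Normal_Form.Schur_Decomposition"
    "HOL-Library.Extended_Real"
begin

text \<open>
  The Hilbert space of a single copy is \<open>\<complex>\<^sup>d\<close> (\<open>carrier_vec d\<close>), and its \<open>N\<close>-th tensor power is
  \<open>carrier_vec (d ^ N)\<close>, the standard product basis being numbered in base \<open>d\<close> with the first
  tensor factor most significant.  The inner product \<open>v \<bullet>c w\<close> of the library is conjugate-linear
  in its second argument, and \<open>z \<le> w\<close> on complex numbers means
  \<open>Re z \<le> Re w\<close> and \<open>Im z = Im w\<close>.
\<close>

definition mat_exp :: "complex mat \<Rightarrow> complex mat" where
  "mat_exp A = mat (dim_row A) (dim_row A) (\<lambda>(i, j). \<Sum>k. (A ^\<^sub>m k) $$ (i, j) / fact k)"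

definition mat_trace :: "complex mat \<Rightarrow> complex" where
  "mat_trace A = (\<Sum>i<dim_row A. A $$ (i, i))"

definition pos_semidef :: "nat \<Rightarrow> complex mat \<Rightarrow> bool" where
  "pos_semidef n A \<longleftrightarrow> A \<in> carrier_mat n n \<and> (\<forall>v\<in>carrier_vec n. 0 \<le> (A *\<^sub>v v) \<bullet>c v)"

text \<open>The rank-one operator \<open>|v\<rangle>\<langle>v|\<close>.\<close>

definition ket_bra :: "complex vec \<Rightarrow> complex mat" where
  "ket_bra v = mat (dim_vec v) (dim_vec v) (\<lambda>(i, j). v $ i * cnj (v $ j))"

definition tensor_vec :: "complex vec \<Rightarrow> complex vec \<Rightarrow> complex vec" where
  "tensor_vec v w =
     vec (dim_vec v * dim_vec w) (\<lambda>i. v $ (i div dim_vec w) * w $ (i mod dim_vec w))"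

definition tensor_mat :: "complex mat \<Rightarrow> complex mat \<Rightarrow> complex mat" where
  "tensor_mat A B =
     mat (dim_row A * dim_row B) (dim_col A * dim_col B)
       (\<lambda>(i, j). A $$ (i div dim_row B, j div dim_col B) * B $$ (i mod dim_row B, j mod dim_col B))"

fun tensor_pow_vec :: "complex vec \<Rightarrow> nat \<Rightarrow> complex vec" where
  "tensor_pow_vec v 0 = vec 1 (\<lambda>_. 1)"
| "tensor_pow_vec v (Suc n) = tensor_vec v (tensor_pow_vec v n)"

fun tensor_pow_mat :: "complex mat \<Rightarrow> nat \<Rightarrow> complex mat" where
  "tensor_pow_mat A 0 = 1\<^sub>m 1"
| "tensor_pow_mat A (Suc n) = tensor_mat A (tensor_pow_mat A n)"

definition linear_map :: "nat \<Rightarrow> nat \<Rightarrow> (complex mat \<Rightarrow> complex mat) \<Rightarrow> bool" where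
  "linear_map n m P \<longleftrightarrow>
     (\<forall>A\<in>carrier_mat n n. P A \<in> carrier_mat m m) \<and>
     (\<forall>A\<in>carrier_mat n n. \<forall>B\<in>carrier_mat n n. P (A + B) = P A + P B) \<and>
     (\<forall>a. \<forall>A\<in>carrier_mat n n. P (a \<cdot>\<^sub>m A) = a \<cdot>\<^sub>m P A)"

text \<open>
  An operator on \<open>\<complex>\<^sup>k \<otimes> \<complex>\<^sup>n\<close> is a \<open>k \<times> k\<close> matrix of \<open>n \<times> n\<close> blocks, and \<open>id\<^sub>k \<otimes> P\<close> applies \<open>P\<close>
  to each of these blocks (see \<open>ampliation_tensor_mat\<close> below).
\<close>

definition block :: "nat \<Rightarrow> complex mat \<Rightarrow> nat \<Rightarrow> nat \<Rightarrow> complex mat" where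
  "block n X a b = mat n n (\<lambda>(r, s). X $$ (a * n + r, b * n + s))"

definition ampliation ::
  "nat \<Rightarrow> nat \<Rightarrow> nat \<Rightarrow> (complex mat \<Rightarrow> complex mat) \<Rightarrow> complex mat \<Rightarrow> complex mat" where
  "ampliation k n m P X =
     mat (k * m) (k * m) (\<lambda>(i, j). P (block n X (i div m) (j div m)) $$ (i mod m, j mod m))"

lemma ampliation_tensor_mat:
  assumes P: "linear_map n m P" and A: "A \<in> carrier_mat k k" and B: "B \<in> carrier_mat n n"
  shows "ampliation k n m P (tensor_mat A B) = tensor_mat A (P B)"
proof -
  have PB: "P B \<in> carrier_mat m m"
    using P B by (simp add: linear_map_def)
  have blk: "block n (tensor_mat A B) a b = A $$ (a, b) \<cdot>\<^sub>m B" if "a < k" "b < k" for a b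
  proof (rule eq_matI)
    fix r s
    assume "r < dim_row (A $$ (a, b) \<cdot>\<^sub>m B)" "s < dim_col (A $$ (a, b) \<cdot>\<^sub>m B)"
    then have rs: "r < n" "s < n"
      using B by auto
    have le: "x * n + y < k * n" if "x < k" "y < n" for x y
    proof -
      have "x * n + y < Suc x * n"
        using that by simp
      also have "\<dots> \<le> k * n"
        using that by (intro mult_le_mono1) simp
      finally show ?thesis .
    qed
    show "block n (tensor_mat A B) a b $$ (r, s) = (A $$ (a, b) \<cdot>\<^sub>m B) $$ (r, s)"
      using A B rs that le by (simp add: block_def tensor_mat_def)
  qed (use B in \<open>simp_all add: block_def\<close>)
  show ?thesis
  proof (rule eq_matI)
    fix i j
    assume "i < dim_row (tensor_mat A (P B))" "j < dim_col (tensor_mat A (P B))"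
    then have ij: "i < k * m" "j < k * m"
      using A PB by (auto simp: tensor_mat_def)
    then have m: "0 < m"
      by (cases m) auto
    have q: "i div m < k" "j div m < k"
      using ij by (auto simp: less_mult_imp_div_less)
    have "ampliation k n m P (tensor_mat A B) $$ (i, j) =
        P (A $$ (i div m, j div m) \<cdot>\<^sub>m B) $$ (i mod m, j mod m)"
      using ij q by (simp add: ampliation_def blk)
    also have "P (A $$ (i div m, j div m) \<cdot>\<^sub>m B) = A $$ (i div m, j div m) \<cdot>\<^sub>m P B"
      using P B by (simp add: linear_map_def)
    also have "(A $$ (i div m, j div m) \<cdot>\<^sub>m P B) $$ (i mod m, j mod m) = tensor_mat A (P B) $$ (i, j)"
      using ij m A PB by (simp add: tensor_mat_def)
    finally show "ampliation k n m P (tensor_mat A B) $$ (i, j) = tensor_mat A (P B) $$ (i, j)" .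
  qed (use A PB in \<open>simp_all add: ampliation_def tensor_mat_def\<close>)
qed

definition completely_positive :: "nat \<Rightarrow> nat \<Rightarrow> (complex mat \<Rightarrow> complex mat) \<Rightarrow> bool" where
  "completely_positive n m P \<longleftrightarrow>
     linear_map n m P \<and>
     (\<forall>k X. pos_semidef (k * n) X \<longrightarrow> pos_semidef (k * m) (ampliation k n m P X))"

definition trace_nonincreasing :: "nat \<Rightarrow> (complex mat \<Rightarrow> complex mat) \<Rightarrow> bool" where
  "trace_nonincreasing n P \<longleftrightarrow> (\<forall>\<rho>. pos_semidef n \<rho> \<longrightarrow> mat_trace (P \<rho>) \<le> mat_trace \<rho>)"

definition replication_process ::
  "nat \<Rightarrow> nat \<Rightarrow> nat \<Rightarrow> (complex mat \<Rightarrow> complex mat) \<Rightarrow> bool" where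
  "replication_process d N M P \<longleftrightarrow>
     completely_positive (d ^ N) (d ^ M) P \<and> trace_nonincreasing (d ^ N) P"

definition clock_state :: "complex mat \<Rightarrow> complex vec \<Rightarrow> real \<Rightarrow> complex vec" where
  "clock_state H \<psi> t = mat_exp ((- \<i> * complex_of_real t) \<cdot>\<^sub>m H) *\<^sub>v \<psi>"

text \<open>
  The traces and expectation values below are real for every replication process; \<open>Re\<close> only
  changes the type.
\<close>

definition success_prob_at ::
  "complex mat \<Rightarrow> complex vec \<Rightarrow> nat \<Rightarrow> (complex mat \<Rightarrow> complex mat) \<Rightarrow> real \<Rightarrow> real" where
  "success_prob_at H \<psi> N P t =
     Re (mat_trace (P (tensor_pow_mat (ket_bra (clock_state H \<psi> t)) N)))"

definition success_prob ::
  "complex mat \<Rightarrow> complex vec \<Rightarrow> nat \<Rightarrow> (complex mat \<Rightarrow> complex mat) \<Rightarrow> real" where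
  "success_prob H \<psi> N P = (INF t. success_prob_at H \<psi> N P t)"

definition fidelity ::
  "complex mat \<Rightarrow> complex vec \<Rightarrow> nat \<Rightarrow> nat \<Rightarrow> (complex mat \<Rightarrow> complex mat) \<Rightarrow> real" where
  "fidelity H \<psi> N M P =
     (INF t\<in>{t. success_prob_at H \<psi> N P t \<noteq> 0}.
        Re ((P (tensor_pow_mat (ket_bra (clock_state H \<psi> t)) N)
               *\<^sub>v tensor_pow_vec (clock_state H \<psi> t) M)
             \<bullet>c tensor_pow_vec (clock_state H \<psi> t) M)
        / success_prob_at H \<psi> N P t)"

end

theory Submission
  imports Defs "HOL-Real_Asymp.Real_Asymp"
begin

text \<open>
  Complete positivity gives Kraus operators, so the success probability becomes
  \<open>\<Sum>\<^sub>l \<parallel>K\<^sub>l u\<parallel>\<^sup>2\<close> and the unnormalised fidelity \<open>\<Sum>\<^sub>l \<bar>\<langle>w, K\<^sub>l u\<rangle>\<bar>\<^sup>2\<close>, where \<open>u\<close> is the state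
  of the \<open>N\<close> input copies and \<open>w\<close> that of the \<open>M\<close> perfect output copies.

  The energy of the input state is concentrated around its mean: with \<open>\<delta> < \<delta>' < \<epsilon>\<close>, the part of it outside
  a window of half-width \<open>L = N\<^bsup>(1+\<delta>')/2\<^esup>\<close> has weight \<open>exp (- const * N\<^bsup>\<delta>'\<^esup>)\<close>, which is negligible
  even relative to a success probability of order \<open>exp (- N\<^bsup>\<delta>\<^esup>)\<close>. The part inside the window
  evolves slowly: up to a phase it hardly changes during a time \<open>K h\<close> with \<open>K h L \<lless> 1\<close>. The
  perfect output states, however, are nearly orthogonal at the times \<open>t, t + h, \<dots>, t + (K - 1) h\<close>,
  because \<open>\<bar>\<langle>\<psi>\<^sub>s, \<psi>\<^sub>t\<rangle>\<bar>\<^sup>M \<le> exp (- q M (s - t)\<^sup>2)\<close> and \<open>M h\<^sup>2 \<ge> const * N\<^bsup>\<epsilon>-\<delta>'\<^esup>\<close> tends to infinity for \<open>h\<close>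
  of order \<open>1 / L\<close>. Hence by Bessel's inequality the fidelity is at most about \<open>4 / K\<close>, for every \<open>K\<close>.

  All relative errors are controlled on average over \<open>t\<close>. The average is taken over a finite set
  of times which annihilates every nonzero frequency that occurs, so that Parseval's identity
  holds exactly.
\<close>

subsection \<open>Almost orthogonal vectors and averages over time\<close>

text \<open>Vectors are functions of which only the indices below \<open>n\<close> matter, so that
  no carrier conditions arise. As for \<open>\<bullet>c\<close>, the second argument is the
  conjugated one.\<close>

definition ip :: "nat \<Rightarrow> (nat \<Rightarrow> complex) \<Rightarrow> (nat \<Rightarrow> complex) \<Rightarrow> complex" where
  "ip n u v = (\<Sum>i<n. u i * cnj (v i))"

definition sqn :: "nat \<Rightarrow> (nat \<Rightarrow> complex) \<Rightarrow> real" where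
  "sqn n u = (\<Sum>i<n. (cmod (u i))\<^sup>2)"

lemma ip_self: "ip n u u = complex_of_real (sqn n u)"
  unfolding ip_def sqn_def of_real_sum complex_norm_square ..

lemma sqn_nonneg [simp]: "0 \<le> sqn n u"
  by (simp add: sqn_def sum_nonneg)

lemma ip_cnj: "cnj (ip n u v) = ip n v u"
  by (simp add: ip_def mult.commute)

lemma cmod_add_sq_le: "(cmod (a + b))\<^sup>2 \<le> 2 * (cmod a)\<^sup>2 + 2 * (cmod b)\<^sup>2"
proof -
  have "(cmod (a + b))\<^sup>2 \<le> (cmod a + cmod b)\<^sup>2"
    by (intro power_mono norm_triangle_ineq) simp
  also have "\<dots> \<le> 2 * (cmod a)\<^sup>2 + 2 * (cmod b)\<^sup>2"
    using zero_le_power2[of "cmod a - cmod b"] by (simp add: power2_eq_square algebra_simps)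
  finally show ?thesis .
qed

text \<open>The Gram matrix of the \<open>\<phi> k\<close> has norm at most
  \<open>1 + real K * \<theta>\<close>. Instead of projecting \<open>y\<close> onto their span, one
  subtracts the damped combination \<open>\<alpha> * z\<close>; that the remainder has nonnegative
  square norm is the claim.\<close>

lemma almost_orthogonal_Bessel:
  fixes \<phi> :: "nat \<Rightarrow> nat \<Rightarrow> complex"
  assumes unit: "\<And>k. k < K \<Longrightarrow> sqn m (\<phi> k) = 1" and \<theta>: "0 \<le> \<theta>"
    and ortho: "\<And>k l. k < K \<Longrightarrow> l < K \<Longrightarrow> k \<noteq> l \<Longrightarrow> cmod (ip m (\<phi> k) (\<phi> l)) \<le> \<theta>"
  shows "(\<Sum>k<K. (cmod (ip m y (\<phi> k)))\<^sup>2) \<le> (1 + real K * \<theta>) * sqn m y"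
proof -
  define c where "c k = ip m y (\<phi> k)" for k
  define Q where "Q = (\<Sum>k<K. (cmod (c k))\<^sup>2)"
  \<comment> \<open>This value minimises \<open>- 2 * \<alpha> * Q + \<alpha>\<^sup>2 * ((1 + real K
    * \<theta>) * Q)\<close>.\<close>
  define \<alpha> where "\<alpha> = 1 / (1 + real K * \<theta>)"
  define z where "z a = (\<Sum>k<K. c k * \<phi> k a)" for a
  have pos: "1 + real K * \<theta> > 0" using \<theta> by (simp add: add_pos_nonneg)
  have yz: "ip m y z = complex_of_real Q"
  proof -
    have "ip m y z = (\<Sum>a<m. \<Sum>k<K. cnj (c k) * (y a * cnj (\<phi> k a)))"
      by (simp add: ip_def z_def sum_distrib_left mult_ac)
    also have "\<dots> = (\<Sum>k<K. \<Sum>a<m. cnj (c k) * (y a * cnj (\<phi> k a)))" by (rule sum.swap)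
    also have "\<dots> = (\<Sum>k<K. cnj (c k) * c k)"
      by (simp add: c_def ip_def sum_distrib_left)
    also have "\<dots> = complex_of_real Q"
      unfolding Q_def of_real_sum complex_norm_square by (simp add: mult.commute)
    finally show ?thesis .
  qed
  have zz: "sqn m z \<le> (1 + real K * \<theta>) * Q"
  proof -
    have "ip m z z = (\<Sum>a<m. \<Sum>k<K. \<Sum>l<K. c k * cnj (c l) * (\<phi> k a * cnj (\<phi> l a)))"
      by (simp add: ip_def z_def sum_product mult_ac)
    also have "\<dots> = (\<Sum>k<K. \<Sum>a<m. \<Sum>l<K. c k * cnj (c l) * (\<phi> k a * cnj (\<phi> l a)))"
      by (rule sum.swap)
    also have "\<dots> = (\<Sum>k<K. \<Sum>l<K. \<Sum>a<m. c k * cnj (c l) * (\<phi> k a * cnj (\<phi> l a)))"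
      by (intro sum.cong refl sum.swap)
    also have "\<dots> = (\<Sum>k<K. \<Sum>l<K. c k * cnj (c l) * ip m (\<phi> k) (\<phi> l))"
      by (simp add: ip_def sum_distrib_left)
    finally have e: "ip m z z = \<dots>" .
    have "sqn m z = cmod (ip m z z)" by (simp add: ip_self)
    also have "\<dots> \<le> (\<Sum>k<K. \<Sum>l<K. cmod (c k * cnj (c l) * ip m (\<phi> k) (\<phi> l)))"
      unfolding e by (intro order_trans[OF norm_sum] sum_mono norm_sum)
    \<comment> \<open>The inequality \<open>a * b \<le> (a\<^sup>2 + b\<^sup>2) / 2\<close>
      decouples \<open>k\<close> and \<open>l\<close>. The \<open>\<theta>\<close> term is granted
      to the diagonal as well, which makes its double sum exactly
      \<open>real K * \<theta> * Q\<close>.\<close>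
    also have "\<dots> \<le> (\<Sum>k<K. \<Sum>l<K. (if k = l then (cmod (c k))\<^sup>2 else 0)
        + \<theta> * (((cmod (c k))\<^sup>2 + (cmod (c l))\<^sup>2) / 2))"
    proof (intro sum_mono)
      fix k l assume kl: "k \<in> {..<K}" "l \<in> {..<K}"
      show "cmod (c k * cnj (c l) * ip m (\<phi> k) (\<phi> l)) \<le>
        (if k = l then (cmod (c k))\<^sup>2 else 0) + \<theta> * (((cmod (c k))\<^sup>2 + (cmod (c l))\<^sup>2) / 2)"
      proof (cases "k = l")
        case True
        then show ?thesis using unit kl \<theta>
          by (simp add: norm_mult ip_self power2_eq_square)
      next
        case False
        have "cmod (c k) * cmod (c l) \<le> ((cmod (c k))\<^sup>2 + (cmod (c l))\<^sup>2) / 2"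
          using zero_le_power2[of "cmod (c k) - cmod (c l)"]
          by (simp add: power2_eq_square algebra_simps)
        then have "cmod (c k) * cmod (c l) * cmod (ip m (\<phi> k) (\<phi> l))
            \<le> ((cmod (c k))\<^sup>2 + (cmod (c l))\<^sup>2) / 2 * \<theta>"
          using ortho[of k l] kl False by (intro mult_mono) auto
        then show ?thesis using False by (simp add: norm_mult mult_ac)
      qed
    qed
    also have "\<dots> = (1 + real K * \<theta>) * Q"
    proof -
      have "(\<Sum>k<K. \<Sum>l<K. (if k = l then (cmod (c k))\<^sup>2 else 0)) = Q"
        by (simp add: Q_def)
      moreover have "(\<Sum>k<K. \<Sum>l<K. \<theta> * (((cmod (c k))\<^sup>2 + (cmod (c l))\<^sup>2) / 2)) = real K * \<theta> * Q"
        by (simp add: sum_distrib_left[symmetric] sum_divide_distrib[symmetric] sum.distrib Q_def)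
      ultimately show ?thesis by (simp add: sum.distrib algebra_simps)
    qed
    finally show ?thesis .
  qed
  have "0 \<le> sqn m (\<lambda>a. y a - complex_of_real \<alpha> * z a)" by simp
  also have "complex_of_real (sqn m (\<lambda>a. y a - complex_of_real \<alpha> * z a))
      = ip m y y - \<alpha> * ip m y z - \<alpha> * cnj (ip m y z) + \<alpha>\<^sup>2 * ip m z z"
    unfolding ip_self[symmetric] ip_cnj
    by (simp add: ip_def algebra_simps sum.distrib sum_subtractf sum_distrib_left power2_eq_square)
  then have "sqn m (\<lambda>a. y a - complex_of_real \<alpha> * z a) = sqn m y - 2 * \<alpha> * Q + \<alpha>\<^sup>2 * sqn m z"
    unfolding yz ip_self
    by (simp flip: of_real_mult of_real_power of_real_diff of_real_add)
  also have "\<dots> \<le> sqn m y - 2 * \<alpha> * Q + \<alpha>\<^sup>2 * ((1 + real K * \<theta>) * Q)"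
    using zz by (intro add_left_mono mult_left_mono) auto
  also have "\<dots> = sqn m y - \<alpha> * Q"
    using pos by (simp add: \<alpha>_def power2_eq_square)
  finally have "\<alpha> * Q \<le> sqn m y" by simp
  then have "Q \<le> (1 + real K * \<theta>) * sqn m y"
    using pos by (simp add: \<alpha>_def field_simps)
  then show ?thesis by (simp add: Q_def c_def)
qed

section \<open>Finite averages over time that annihilate given frequencies\<close>

text \<open>Joining a list of times with its translate by \<open>pi / x\<close> multiplies the
  exponential sum at frequency \<open>s\<close> by \<open>1 + cis (pi / x * s)\<close>. This factor
  vanishes at \<open>s = x\<close>, and zeros already obtained persist, so the frequencies are
  killed one after another. Times may repeat, hence a list or an indexed family rather than a
  set.\<close>

lemma annihilating_times:
  fixes D :: "real set"
  assumes "finite D" "0 \<notin> D"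
  shows "\<exists>(n::nat) T. 0 < n \<and> (\<forall>s\<in>D. (\<Sum>k<n. cis (T k * s)) = 0)"
proof -
  have "\<exists>ts. ts \<noteq> [] \<and> (\<forall>s\<in>D. (\<Sum>t\<leftarrow>ts. cis (t * s)) = 0)"
    using assms
  proof (induction D rule: finite_induct)
    case empty
    show ?case by (intro exI[of _ "[0]"]) simp
  next
    case (insert x D)
    then obtain ts where ts: "ts \<noteq> []" "\<forall>s\<in>D. (\<Sum>t\<leftarrow>ts. cis (t * s)) = 0" by auto
    have shift: "(\<Sum>t\<leftarrow>ts @ map (\<lambda>t. t + pi / x) ts. cis (t * s))
        = (1 + cis (pi / x * s)) * (\<Sum>t\<leftarrow>ts. cis (t * s))" for s
    proof (induction ts)
      case (Cons a ts)
      have "cis ((a + pi / x) * s) = cis (pi / x * s) * cis (a * s)"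
        by (simp add: cis_mult algebra_simps)
      with Cons show ?case
        by (simp add: distrib_left distrib_right)
    qed simp
    show ?case
    proof (intro exI[of _ "ts @ map (\<lambda>t. t + pi / x) ts"] conjI ballI)
      fix s assume "s \<in> insert x D"
      then show "(\<Sum>t\<leftarrow>ts @ map (\<lambda>t. t + pi / x) ts. cis (t * s)) = 0"
        unfolding shift using ts insert.prems by auto
    qed (use ts in simp)
  qed
  then obtain ts where ts: "ts \<noteq> []" "\<forall>s\<in>D. (\<Sum>t\<leftarrow>ts. cis (t * s)) = 0" by blast
  show ?thesis
    using ts by (intro exI[of _ "length ts"] exI[of _ "\<lambda>k. ts ! k"])
      (auto simp: sum_list_sum_nth atLeast0LessThan)
qed

text \<open>When the square is multiplied out, the cross term of \<open>E\<close> and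
  \<open>F\<close> carries \<open>cis (T k * (F - E))\<close>, whose sum over \<open>k\<close>
  vanishes for \<open>E \<noteq> F\<close>.\<close>

lemma Parseval_times:
  fixes z :: "real \<Rightarrow> complex"
  assumes S: "finite S"
    and T: "\<And>E F. E \<in> S \<Longrightarrow> F \<in> S \<Longrightarrow> E \<noteq> F \<Longrightarrow> (\<Sum>k<n. cis (T k * (E - F))) = 0"
  shows "(\<Sum>k<n. (cmod (\<Sum>E\<in>S. cis (- (T k * E)) * z E))\<^sup>2) = real n * (\<Sum>E\<in>S. (cmod (z E))\<^sup>2)"
proof -
  have "complex_of_real (\<Sum>k<n. (cmod (\<Sum>E\<in>S. cis (- (T k * E)) * z E))\<^sup>2)
      = (\<Sum>k<n. \<Sum>E\<in>S. \<Sum>F\<in>S.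
          (cis (- (T k * E)) * z E) * cnj (cis (- (T k * F)) * z F))"
    unfolding of_real_sum complex_norm_square cnj_sum sum_product ..
  also have "\<dots> = (\<Sum>k<n. \<Sum>E\<in>S. \<Sum>F\<in>S. (z E * cnj (z F)) * cis (T k * (F - E)))"
    by (intro sum.cong refl) (simp add: cis_cnj cis_mult mult_ac right_diff_distrib)
  also have "\<dots> = (\<Sum>E\<in>S. \<Sum>k<n. \<Sum>F\<in>S. (z E * cnj (z F)) * cis (T k * (F - E)))"
    by (rule sum.swap)
  also have "\<dots> = (\<Sum>E\<in>S. \<Sum>F\<in>S. \<Sum>k<n. (z E * cnj (z F)) * cis (T k * (F - E)))"
    by (intro sum.cong refl sum.swap)
  also have "\<dots> = (\<Sum>E\<in>S. \<Sum>F\<in>S. if E = F then of_nat n * (z E * cnj (z E)) else 0)"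
  proof (intro sum.cong refl)
    fix E F assume "E \<in> S" "F \<in> S"
    then show "(\<Sum>k<n. (z E * cnj (z F)) * cis (T k * (F - E)))
        = (if E = F then of_nat n * (z E * cnj (z E)) else 0)"
      using T[of F E] by (cases "E = F") (simp_all flip: sum_distrib_left)
  qed
  also have "\<dots> = complex_of_real (real n * (\<Sum>E\<in>S. (cmod (z E))\<^sup>2))"
    unfolding of_real_mult of_real_sum complex_norm_square sum_distrib_left using S by simp
  finally show ?thesis by (simp only: of_real_eq_iff)
qed

subsection \<open>Gram and Kraus decompositions\<close>

text \<open>The form is tested on vectors supported at two indices. Suitable \<open>a\<close> and
  \<open>b\<close> later give Hermitian symmetry and the vanishing of rows with zero diagonal
  entry.\<close>

lemma form_two_points:
  fixes C :: "'a \<Rightarrow> 'a \<Rightarrow> complex"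
  assumes "finite I" "x \<in> I" "y \<in> I" "x \<noteq> y"
    and pos: "\<And>Z. 0 \<le> (\<Sum>p\<in>I. \<Sum>q\<in>I. C p q * Z q * cnj (Z p))"
  shows "0 \<le> C x x * (a * cnj a) + C y y * (b * cnj b) + C x y * b * cnj a + C y x * a * cnj b"
proof -
  define Z where "Z p = (if p = x then a else if p = y then b else 0)" for p
  have "(\<Sum>p\<in>I. \<Sum>q\<in>I. C p q * Z q * cnj (Z p)) = (\<Sum>p\<in>{x,y}. \<Sum>q\<in>I. C p q * Z q * cnj (Z p))"
    using assms by (intro sum.mono_neutral_right) (auto simp: Z_def)
  also have "\<dots> = (\<Sum>p\<in>{x,y}. \<Sum>q\<in>{x,y}. C p q * Z q * cnj (Z p))"
    using assms by (intro sum.cong refl sum.mono_neutral_right) (auto simp: Z_def)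
  also have "\<dots> = C x x * (a * cnj a) + C y y * (b * cnj b) + C x y * b * cnj a + C y x * a * cnj b"
    using assms by (simp add: Z_def algebra_simps)
  finally show ?thesis using pos[of Z] by simp
qed

lemma form_diag:
  fixes C :: "'a \<Rightarrow> 'a \<Rightarrow> complex"
  assumes I: "finite I" "x \<in> I"
    and pos: "\<And>Z. 0 \<le> (\<Sum>p\<in>I. \<Sum>q\<in>I. C p q * Z q * cnj (Z p))"
  shows "0 \<le> C x x"
proof -
  define Z where "Z p = (if p = x then 1 else 0 :: complex)" for p
  have "(\<Sum>p\<in>I. \<Sum>q\<in>I. C p q * Z q * cnj (Z p)) = (\<Sum>p\<in>{x}. \<Sum>q\<in>I. C p q * Z q * cnj (Z p))"
    using I by (intro sum.mono_neutral_right) (auto simp: Z_def)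
  also have "\<dots> = (\<Sum>p\<in>{x}. \<Sum>q\<in>{x}. C p q * Z q * cnj (Z p))"
    using I by (intro sum.cong refl sum.mono_neutral_right) (auto simp: Z_def)
  finally show ?thesis using pos[of Z] by (simp add: Z_def)
qed

text \<open>On complex numbers \<open>0 \<le> z\<close> includes \<open>Im z = 0\<close>. The test
  vectors \<open>(1, 1)\<close> and \<open>(1, \<i>)\<close> therefore tie the imaginary and the
  real part of \<open>C y x\<close> to those of \<open>C x y\<close>.\<close>

lemma form_hermitian:
  fixes C :: "'a \<Rightarrow> 'a \<Rightarrow> complex"
  assumes I: "finite I" "x \<in> I" "y \<in> I"
    and pos: "\<And>Z. 0 \<le> (\<Sum>p\<in>I. \<Sum>q\<in>I. C p q * Z q * cnj (Z p))"
  shows "C y x = cnj (C x y)"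
proof (cases "x = y")
  case True
  then show ?thesis using form_diag[OF I(1,2) pos]
    by (simp add: less_eq_complex_def complex_eq_iff)
next
  case False
  have "Im (C x x) = 0" "Im (C y y) = 0"
    using form_diag[OF I(1,2) pos] form_diag[OF I(1,3) pos] by (auto simp: less_eq_complex_def)
  then show ?thesis
    using form_two_points[OF I False pos, of 1 1] form_two_points[OF I False pos, of 1 \<i>]
    by (simp add: less_eq_complex_def complex_eq_iff)
qed

lemma form_zero_row:
  fixes C :: "'a \<Rightarrow> 'a \<Rightarrow> complex"
  assumes I: "finite I" "x \<in> I" "y \<in> I"
    and pos: "\<And>Z. 0 \<le> (\<Sum>p\<in>I. \<Sum>q\<in>I. C p q * Z q * cnj (Z p))"
    and zero: "C x x = 0"
  shows "C x y = 0"
proof (rule ccontr)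
  assume nz: "C x y \<noteq> 0"
  then have ne: "x \<noteq> y" using zero by auto
  \<comment> \<open>At the test vector \<open>(- r * C x y, 1)\<close> the form has the value
    \<open>C y y - 2 * r * (cmod (C x y))\<^sup>2\<close>; this \<open>r\<close> turns it into
    \<open>- C y y - 2\<close>, which is negative.\<close>
  define r where "r = (Re (C y y) + 1) / (cmod (C x y))\<^sup>2"
  have h: "C y x = cnj (C x y)" by (rule form_hermitian[OF I pos])
  have "0 \<le> C y y - complex_of_real (2 * r * (cmod (C x y))\<^sup>2)"
    using form_two_points[OF I ne pos, of "- complex_of_real r * C x y" 1] zero
    unfolding of_real_mult complex_norm_square h by (simp add: algebra_simps)
  then have "0 \<le> Re (C y y) - 2 * r * (cmod (C x y))\<^sup>2" by (simp add: less_eq_complex_def)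
  moreover have "r * (cmod (C x y))\<^sup>2 = Re (C y y) + 1" using nz by (simp add: r_def)
  moreover have "0 \<le> Re (C y y)" using form_diag[OF I(1,3) pos] by (simp add: less_eq_complex_def)
  ultimately show False by linarith
qed

text \<open>Cholesky elimination: the index \<open>x\<close> splits off one rank-one term, and the
  Schur complement \<open>C'\<close> is again a nonnegative form on the smaller index set.\<close>

lemma Gram_decomposition:
  fixes C :: "'a \<Rightarrow> 'a \<Rightarrow> complex"
  assumes "finite I" and "\<And>Z. 0 \<le> (\<Sum>p\<in>I. \<Sum>q\<in>I. C p q * Z q * cnj (Z p))"
  shows "\<exists>(R::nat) k. \<forall>p\<in>I. \<forall>q\<in>I. C p q = (\<Sum>l<R. k l p * cnj (k l q))"
  using assms
proof (induction I arbitrary: C rule: finite_induct)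
  case empty
  then show ?case by simp
next
  case (insert x I)
  note pos = insert.prems
  have fin: "finite (insert x I)" using insert.hyps by simp
  define c where "c = Re (C x x)"
  have c: "C x x = complex_of_real c" "0 \<le> c"
    using form_diag[OF fin _ pos, of x] by (auto simp: c_def less_eq_complex_def complex_eq_iff)
  have herm: "C q p = cnj (C p q)" if "p \<in> insert x I" "q \<in> insert x I" for p q
    using form_hermitian[OF fin that pos] .
  have zero: "C x q = 0" "C q x = 0" if "c = 0" "q \<in> insert x I" for q
    using form_zero_row[OF fin _ that(2) pos] herm[of x q] that c by auto
  \<comment> \<open>If \<open>c = 0\<close>, division by zero yields \<open>C' = C\<close>, which is
    right because row and column \<open>x\<close> then vanish.\<close>
  define C' where "C' p q = C p q - C p x * C x q / c" for p q
  have "0 \<le> (\<Sum>p\<in>I. \<Sum>q\<in>I. C' p q * Z q * cnj (Z p))" for Z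
  proof -
    define s where "s = (\<Sum>q\<in>I. C x q * Z q)"
    have s': "(\<Sum>p\<in>I. C p x * cnj (Z p)) = cnj s"
      unfolding s_def cnj_sum by (intro sum.cong refl) (simp add: herm[of x])
    \<comment> \<open>The coordinate at \<open>x\<close> completes the square: the form of
      \<open>C\<close> at \<open>W\<close> is exactly the form of \<open>C'\<close> at
      \<open>Z\<close>.\<close>
    define W where "W = Z(x := - s / c)"
    have WZ: "(\<Sum>q\<in>I. g q (W q)) = (\<Sum>q\<in>I. g q (Z q))" for g :: "'a \<Rightarrow> complex \<Rightarrow> complex"
      using insert.hyps by (intro sum.cong) (auto simp: W_def)
    have "0 \<le> (\<Sum>p\<in>insert x I. \<Sum>q\<in>insert x I. C p q * W q * cnj (W p))" by (rule pos)
    also have "\<dots> = c * W x * cnj (W x) + cnj (W x) * (\<Sum>q\<in>I. C x q * W q)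
        + W x * (\<Sum>p\<in>I. C p x * cnj (W p)) + (\<Sum>p\<in>I. \<Sum>q\<in>I. C p q * W q * cnj (W p))"
      using insert.hyps by (simp add: c sum.distrib sum_distrib_left algebra_simps)
    also have "(\<Sum>q\<in>I. C x q * W q) = s" using WZ[of "\<lambda>q z. C x q * z"] by (simp add: s_def)
    also have "(\<Sum>p\<in>I. C p x * cnj (W p)) = cnj s"
      using WZ[of "\<lambda>q z. C q x * cnj z"] by (simp add: s')
    also have "(\<Sum>p\<in>I. \<Sum>q\<in>I. C p q * W q * cnj (W p)) = (\<Sum>p\<in>I. \<Sum>q\<in>I. C p q * Z q * cnj (Z p))"
      using insert.hyps by (intro sum.cong refl) (auto simp: W_def)
    also have "c * W x * cnj (W x) + cnj (W x) * s + W x * cnj s = - (s * cnj s / c)"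
      by (cases "c = 0") (simp_all add: W_def field_simps)
    also have "s * cnj s / c = (\<Sum>p\<in>I. \<Sum>q\<in>I. C p x * C x q / c * Z q * cnj (Z p))"
      unfolding s'[symmetric] unfolding s_def
      by (simp add: sum_product sum_divide_distrib mult_ac, rule sum.swap)
    finally show ?thesis
      by (simp add: C'_def sum_subtractf algebra_simps)
  qed
  from insert.IH[OF this] obtain R :: nat and k where
    k: "\<forall>p\<in>I. \<forall>q\<in>I. C' p q = (\<Sum>l<R. k l p * cnj (k l q))" by blast
  \<comment> \<open>The new vector is the normalised column of \<open>x\<close>; the old ones are
    extended by zero at \<open>x\<close>.\<close>
  define k' where "k' l p = (case l of 0 \<Rightarrow> C p x / sqrt c | Suc l \<Rightarrow> if p = x then 0 else k l p)"
    for l :: nat and p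
  have sqrt: "complex_of_real (sqrt c) * complex_of_real (sqrt c) = c"
    using c(2) by (simp flip: of_real_mult)
  have "C p q = (\<Sum>l<Suc R. k' l p * cnj (k' l q))" if pq: "p \<in> insert x I" "q \<in> insert x I" for p q
  proof -
    have "(\<Sum>l<Suc R. k' l p * cnj (k' l q))
        = C p x * C x q / c + (if p = x \<or> q = x then 0 else (\<Sum>l<R. k l p * cnj (k l q)))"
      unfolding sum.lessThan_Suc_shift
      using herm[OF pq(2), of x] sqrt by (simp add: k'_def times_divide_times_eq)
    also have "\<dots> = C p q"
    proof (cases "p = x \<or> q = x")
      case True
      then show ?thesis using zero pq c by (cases "c = 0") auto
    next
      case False
      then have "C' p q = (\<Sum>l<R. k l p * cnj (k l q))" using k pq by blast
      then show ?thesis using False by (simp add: C'_def algebra_simps)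
    qed
    finally show ?thesis ..
  qed
  then show ?case by blast
qed

section \<open>Coordinates of operators and the Kraus form of a completely positive map\<close>

definition app :: "nat \<Rightarrow> (nat \<Rightarrow> nat \<Rightarrow> complex) \<Rightarrow> (nat \<Rightarrow> complex) \<Rightarrow> nat \<Rightarrow> complex" where
  "app n k u a = (\<Sum>i<n. k a i * u i)"

lemma cinner_conv_ip: "v \<in> carrier_vec n \<Longrightarrow> w \<in> carrier_vec n \<Longrightarrow> v \<bullet>c w = ip n (($) v) (($) w)"
  by (simp add: scalar_prod_def ip_def atLeast0LessThan)

lemma mult_mat_vec_index:
  "A \<in> carrier_mat n m \<Longrightarrow> v \<in> carrier_vec m \<Longrightarrow> i < n \<Longrightarrow> (A *\<^sub>v v) $ i = (\<Sum>j<m. A $$ (i, j) * v $ j)"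
  by (simp add: scalar_prod_def atLeast0LessThan)

lemma cinner_mult_mat_vec:
  assumes A: "A \<in> carrier_mat n n" and v: "v \<in> carrier_vec n" and w: "w \<in> carrier_vec n"
  shows "(A *\<^sub>v v) \<bullet>c w = (\<Sum>i<n. \<Sum>j<n. A $$ (i, j) * v $ j * cnj (w $ i))"
proof -
  have "A *\<^sub>v v \<in> carrier_vec n" using A v by (rule mult_mat_vec_carrier)
  then have "(A *\<^sub>v v) \<bullet>c w = (\<Sum>i<n. (A *\<^sub>v v) $ i * cnj (w $ i))"
    using w by (simp only: cinner_conv_ip[of _ n] ip_def)
  also have "\<dots> = (\<Sum>i<n. \<Sum>j<n. A $$ (i, j) * v $ j * cnj (w $ i))"
    by (intro sum.cong refl) (simp only: lessThan_iff mult_mat_vec_index[OF A v] sum_distrib_right)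
  finally show ?thesis .
qed

lemma pos_semidef_ket_bra: "v \<in> carrier_vec n \<Longrightarrow> pos_semidef n (ket_bra v)"
proof -
  assume v: "v \<in> carrier_vec n"
  have c: "ket_bra v \<in> carrier_mat n n" using v by (simp add: ket_bra_def)
  have "0 \<le> (ket_bra v *\<^sub>v w) \<bullet>c w" if w: "w \<in> carrier_vec n" for w
  proof -
    have "(ket_bra v *\<^sub>v w) \<bullet>c w = (\<Sum>i<n. \<Sum>j<n. v $ i * cnj (v $ j) * w $ j * cnj (w $ i))"
      using v unfolding cinner_mult_mat_vec[OF c w w] by (simp add: ket_bra_def)
    also have "\<dots> = (\<Sum>i<n. v $ i * cnj (w $ i)) * cnj (\<Sum>i<n. v $ i * cnj (w $ i))"
      by (simp add: sum_product sum_distrib_left sum_distrib_right mult_ac, rule sum.swap)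
    also have "\<dots> = complex_of_real ((cmod (\<Sum>i<n. v $ i * cnj (w $ i)))\<^sup>2)"
      by (rule complex_norm_square[symmetric])
    finally show ?thesis by (simp add: less_eq_complex_def)
  qed
  with c show ?thesis by (simp add: pos_semidef_def)
qed

lemma pair_index_less: "i < n \<Longrightarrow> a < m \<Longrightarrow> i * m + a < n * (m::nat)"
proof -
  assume "i < n" "a < m"
  then have "i * m + a < Suc i * m" by simp
  also have "\<dots> \<le> n * m" using \<open>i < n\<close> by (intro mult_le_mono1) simp
  finally show ?thesis .
qed

text \<open>Expansion in matrix units, by induction over the set of positions at which the entries
  of \<open>A\<close> are kept.\<close>

lemma linear_map_entry:
  assumes P: "linear_map n m P" and A: "A \<in> carrier_mat n n" and ab: "a < m" "b < m"
  shows "P A $$ (a, b) =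
    (\<Sum>(i,j)\<in>{..<n}\<times>{..<n}. A $$ (i, j) * P (mat n n (\<lambda>p. if p = (i, j) then 1 else 0)) $$ (a, b))"
proof -
  define U where "U p = mat n n (\<lambda>q. if q = p then 1 else (0::complex))" for p
  define c where "c Q = mat n n (\<lambda>p. if p \<in> Q then A $$ p else (0::complex))" for Q
  have U[simp]: "U p \<in> carrier_mat n n" and c[simp]: "c Q \<in> carrier_mat n n" for p Q
    by (simp_all add: U_def c_def)
  have Pc: "P B \<in> carrier_mat m m" if "B \<in> carrier_mat n n" for B
    using P that by (simp add: linear_map_def)
  have Padd: "P (B + D) = P B + P D" if "B \<in> carrier_mat n n" "D \<in> carrier_mat n n" for B D
    using P that by (simp add: linear_map_def)
  have Psm: "P (z \<cdot>\<^sub>m B) = z \<cdot>\<^sub>m P B" if "B \<in> carrier_mat n n" for B z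
    using P that by (simp add: linear_map_def)
  have "finite Q \<Longrightarrow> Q \<subseteq> {..<n}\<times>{..<n} \<Longrightarrow> P (c Q) $$ (a, b) = (\<Sum>p\<in>Q. A $$ p * P (U p) $$ (a, b))" for Q
  proof (induction Q rule: finite_induct)
    case empty
    \<comment> \<open>\<open>linear_map\<close> speaks of sums and multiples; the value at the zero
      matrix comes from scaling by \<open>0\<close>.\<close>
    have "c {} = 0 \<cdot>\<^sub>m c {}" by (rule eq_matI) (auto simp: c_def)
    then have "P (c {}) = 0 \<cdot>\<^sub>m P (c {})" using Psm c by metis
    then have "P (c {}) $$ (a, b) = (0 \<cdot>\<^sub>m P (c {})) $$ (a, b)" by simp
    also have "\<dots> = 0" using Pc[OF c, of "{}"] ab by simp
    finally show ?case by simp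
  next
    case (insert p Q)
    have "c (insert p Q) = A $$ p \<cdot>\<^sub>m U p + c Q"
      using insert by (intro eq_matI) (auto simp: c_def U_def)
    then have "P (c (insert p Q)) $$ (a, b) = A $$ p * P (U p) $$ (a, b) + P (c Q) $$ (a, b)"
      using Pc[OF U, of p] Pc[OF c, of Q] ab by (simp add: Padd Psm)
    then show ?case using insert by simp
  qed
  from this[of "{..<n}\<times>{..<n}"]
  have "P (c ({..<n}\<times>{..<n})) $$ (a, b) = (\<Sum>p\<in>{..<n}\<times>{..<n}. A $$ p * P (U p) $$ (a, b))" by simp
  moreover have "c ({..<n}\<times>{..<n}) = A" using A by (intro eq_matI) (auto simp: c_def)
  ultimately show ?thesis by (simp add: U_def case_prod_unfold)
qed

text \<open>Choi's argument: \<open>J\<close> is the image of the unnormalised maximally entangled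
  state \<open>\<Omega>\<close>, and its entry at \<open>(i * m + a, j * m + b)\<close> is the
  \<open>(a, b)\<close> entry of the image of the matrix unit \<open>U i j\<close>. The vectors of a
  Gram decomposition of \<open>J\<close>, read as \<open>m\<close> by \<open>n\<close> matrices, are
  the Kraus operators.\<close>

lemma Kraus_decomposition:
  assumes CP: "completely_positive n m P"
  shows "\<exists>(R::nat) \<kappa>. \<forall>u\<in>carrier_vec n. \<forall>a<m. \<forall>b<m.
    P (ket_bra u) $$ (a, b) = (\<Sum>l<R. app n (\<kappa> l) (($) u) a * cnj (app n (\<kappa> l) (($) u) b))"
proof -
  define \<Omega> where "\<Omega> = ket_bra (vec (n * n) (\<lambda>p. if p div n = p mod n then 1 else (0::complex)))"
  define J where "J = ampliation n n m P \<Omega>"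
  define U where "U i j = mat n n (\<lambda>q. if q = (i, j) then 1 else (0::complex))" for i j
  have lin: "linear_map n m P" using CP by (simp add: completely_positive_def)
  have "pos_semidef (n * n) \<Omega>" unfolding \<Omega>_def by (rule pos_semidef_ket_bra) simp
  then have psd: "pos_semidef (n * m) J"
    using CP unfolding J_def completely_positive_def by blast
  then have J: "J \<in> carrier_mat (n * m) (n * m)" by (simp add: pos_semidef_def)
  have blk: "block n \<Omega> i j = U i j" if "i < n" "j < n" for i j
  proof (rule eq_matI)
    fix r s assume "r < dim_row (U i j)" "s < dim_col (U i j)"
    then have "r < n" "s < n" by (auto simp: U_def)
    then show "block n \<Omega> i j $$ (r, s) = U i j $$ (r, s)"
      using that pair_index_less[of i n r n] pair_index_less[of j n s n]
      by (auto simp: block_def \<Omega>_def ket_bra_def U_def)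
  qed (simp_all add: block_def U_def)
  have Jent: "J $$ (i * m + a, j * m + b) = P (U i j) $$ (a, b)" if "i < n" "j < n" "a < m" "b < m" for i j a b
    using that pair_index_less[of i n a m] pair_index_less[of j n b m]
    by (simp add: J_def ampliation_def blk)
  have "0 \<le> (\<Sum>p<n*m. \<Sum>q<n*m. J $$ (p, q) * Z q * cnj (Z p))" for Z
  proof -
    have v: "vec (n * m) Z \<in> carrier_vec (n * m)" by simp
    then have "0 \<le> (J *\<^sub>v vec (n * m) Z) \<bullet>c vec (n * m) Z"
      using psd unfolding pos_semidef_def by blast
    also have "\<dots> = (\<Sum>p<n*m. \<Sum>q<n*m. J $$ (p, q) * Z q * cnj (Z p))"
      unfolding cinner_mult_mat_vec[OF J v v] by simp
    finally show ?thesis .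
  qed
  from Gram_decomposition[of "{..<n*m}" "\<lambda>p q. J $$ (p, q)", OF _ this] obtain R :: nat and k where
    k: "\<forall>p\<in>{..<n*m}. \<forall>q\<in>{..<n*m}. J $$ (p, q) = (\<Sum>l<R. k l p * cnj (k l q))"
    by auto
  show ?thesis
  proof (intro exI[of _ R] exI[of _ "\<lambda>l a i. k l (i * m + a)"] ballI allI impI)
    fix u :: "complex vec" and a b assume u: "u \<in> carrier_vec n" and ab: "a < m" "b < m"
    have "P (ket_bra u) $$ (a, b) = (\<Sum>i<n. \<Sum>j<n. u $ i * cnj (u $ j) * P (U i j) $$ (a, b))"
      using u by (subst linear_map_entry[OF lin _ ab])
        (auto simp: ket_bra_def U_def sum.cartesian_product intro!: sum.cong)
    also have "\<dots> = (\<Sum>i<n. \<Sum>j<n. \<Sum>l<R. (k l (i * m + a) * u $ i) * cnj (k l (j * m + b) * u $ j))"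
    proof (intro sum.cong refl)
      fix i j assume "i \<in> {..<n}" "j \<in> {..<n}"
      then have ij: "i < n" "j < n" by auto
      then have "P (U i j) $$ (a, b) = (\<Sum>l<R. k l (i * m + a) * cnj (k l (j * m + b)))"
        using k ab pair_index_less[of i n a m] pair_index_less[of j n b m] Jent[OF ij ab] by auto
      then show "u $ i * cnj (u $ j) * P (U i j) $$ (a, b)
          = (\<Sum>l<R. (k l (i * m + a) * u $ i) * cnj (k l (j * m + b) * u $ j))"
        by (simp add: sum_distrib_left mult_ac)
    qed
    also have "\<dots> = (\<Sum>i<n. \<Sum>l<R. \<Sum>j<n. (k l (i * m + a) * u $ i) * cnj (k l (j * m + b) * u $ j))"
      by (intro sum.cong refl sum.swap)
    also have "\<dots> = (\<Sum>l<R. \<Sum>i<n. \<Sum>j<n. (k l (i * m + a) * u $ i) * cnj (k l (j * m + b) * u $ j))"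
      by (rule sum.swap)
    also have "\<dots> = (\<Sum>l<R. app n (\<lambda>a i. k l (i * m + a)) (($) u) a *
        cnj (app n (\<lambda>a i. k l (i * m + a)) (($) u) b))"
      by (simp add: app_def sum_product)
    finally show "P (ket_bra u) $$ (a, b) = \<dots>" .
  qed
qed

subsection \<open>A bound on the fidelity of Kraus operators\<close>

definition yield_norm ::
  "nat \<Rightarrow> nat \<Rightarrow> nat \<Rightarrow> (nat \<Rightarrow> nat \<Rightarrow> nat \<Rightarrow> complex) \<Rightarrow> (nat \<Rightarrow> complex) \<Rightarrow> real" where
  "yield_norm n m R \<kappa> u = (\<Sum>l<R. sqn m (app n (\<kappa> l) u))"

definition overlap ::
  "nat \<Rightarrow> nat \<Rightarrow> nat \<Rightarrow> (nat \<Rightarrow> nat \<Rightarrow> nat \<Rightarrow> complex) \<Rightarrow> (nat \<Rightarrow> complex) \<Rightarrow> (nat \<Rightarrow> complex) \<Rightarrow> real" where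
  "overlap n m R \<kappa> w u = (\<Sum>l<R. (cmod (ip m (app n (\<kappa> l) u) w))\<^sup>2)"

lemma app_cong: "(\<And>i. i < n \<Longrightarrow> u i = v i) \<Longrightarrow> app n k u = app n k v"
  by (simp add: app_def fun_eq_iff)

lemma app_sum: "app n k (\<lambda>i. \<Sum>E\<in>S. c E * A E i) a = (\<Sum>E\<in>S. c E * app n k (A E) a)"
  unfolding app_def sum_distrib_left by (subst sum.swap) (simp add: mult_ac)

lemma app_add: "app n k (\<lambda>i. u i + v i) a = app n k u a + app n k v a"
  by (simp add: app_def sum.distrib algebra_simps)

lemma app_scale: "app n k (\<lambda>i. c * u i) a = c * app n k u a"
  by (simp add: app_def sum_distrib_left mult_ac)

lemma ip_add_left: "ip m (\<lambda>i. u i + v i) w = ip m u w + ip m v w"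
  by (simp add: ip_def sum.distrib algebra_simps)

lemma ip_scale_left: "ip m (\<lambda>i. c * u i) w = c * ip m u w"
  by (simp add: ip_def sum_distrib_left mult_ac)

lemma yield_norm_nonneg: "0 \<le> yield_norm n m R \<kappa> u"
  by (simp add: yield_norm_def sum_nonneg)

lemma overlap_add: "overlap n m R \<kappa> w (\<lambda>i. u i + v i) \<le> 2 * overlap n m R \<kappa> w u + 2 * overlap n m R \<kappa> w v"
proof -
  have "app n (\<kappa> l) (\<lambda>i. u i + v i) = (\<lambda>a. app n (\<kappa> l) u a + app n (\<kappa> l) v a)" for l
    by (simp add: fun_eq_iff app_add)
  then show ?thesis
    unfolding overlap_def sum_distrib_left sum.distrib[symmetric]
    by (simp only: ip_add_left sum_mono cmod_add_sq_le)
qed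

lemma overlap_phase: "cmod c = 1 \<Longrightarrow> overlap n m R \<kappa> w (\<lambda>i. c * u i) = overlap n m R \<kappa> w u"
proof -
  assume "cmod c = 1"
  moreover have "app n (\<kappa> l) (\<lambda>i. c * u i) = (\<lambda>a. c * app n (\<kappa> l) u a)" for l
    by (simp add: fun_eq_iff app_scale)
  ultimately show ?thesis by (simp add: overlap_def ip_scale_left norm_mult)
qed

text \<open>Bessel's inequality for each Kraus output. This is the source of the
  \<open>1 / real K\<close> in the final bound: one output cannot overlap strongly with
  \<open>K\<close> nearly orthogonal targets at once.\<close>

lemma sum_overlap_le:
  assumes "\<And>k. k < K \<Longrightarrow> sqn m (\<phi> k) = 1" and "0 \<le> \<theta>"
    and "\<And>k l. k < K \<Longrightarrow> l < K \<Longrightarrow> k \<noteq> l \<Longrightarrow> cmod (ip m (\<phi> k) (\<phi> l)) \<le> \<theta>"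
  shows "(\<Sum>k<K. overlap n m R \<kappa> (\<phi> k) u) \<le> (1 + real K * \<theta>) * yield_norm n m R \<kappa> u"
  unfolding overlap_def yield_norm_def sum_distrib_left
  by (subst sum.swap) (intro sum_mono almost_orthogonal_Bessel assms)

lemma overlap_le: "sqn m w = 1 \<Longrightarrow> overlap n m R \<kappa> w u \<le> yield_norm n m R \<kappa> u"
  using sum_overlap_le[of 1 m "\<lambda>_. w" 0 n R \<kappa> u] by simp

text \<open>Each coordinate of each Kraus output is a trigonometric sum in the time with frequencies
  in \<open>S\<close>, so Parseval's identity applies coordinate by coordinate.\<close>

lemma yield_norm_Parseval:
  assumes S: "finite S"
    and T: "\<And>E F. E \<in> S \<Longrightarrow> F \<in> S \<Longrightarrow> E \<noteq> F \<Longrightarrow> (\<Sum>j<N. cis (T j * (E - F))) = 0"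
  shows "(\<Sum>j<N. yield_norm n m R \<kappa> (\<lambda>i. \<Sum>E\<in>S. cis (- (T j * E)) * (z E * A E i)))
    = real N * (\<Sum>E\<in>S. (cmod (z E))\<^sup>2 * yield_norm n m R \<kappa> (A E))"
proof -
  have a: "app n (\<kappa> l) (\<lambda>i. \<Sum>E\<in>S. cis (- (T j * E)) * (z E * A E i)) a
      = (\<Sum>E\<in>S. cis (- (T j * E)) * (z E * app n (\<kappa> l) (A E) a))" for l j a
    by (simp add: app_sum[of n "\<kappa> l" "\<lambda>E. cis (- (T j * E)) * z E" A, simplified mult.assoc])
  have "(\<Sum>j<N. yield_norm n m R \<kappa> (\<lambda>i. \<Sum>E\<in>S. cis (- (T j * E)) * (z E * A E i)))
      = (\<Sum>j<N. \<Sum>l<R. \<Sum>a<m. (cmod (\<Sum>E\<in>S. cis (- (T j * E)) * (z E * app n (\<kappa> l) (A E) a)))\<^sup>2)"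
    by (simp add: yield_norm_def sqn_def a)
  also have "\<dots> = (\<Sum>l<R. \<Sum>j<N. \<Sum>a<m. (cmod (\<Sum>E\<in>S. cis (- (T j * E)) * (z E * app n (\<kappa> l) (A E) a)))\<^sup>2)"
    by (rule sum.swap)
  also have "\<dots> = (\<Sum>l<R. \<Sum>a<m. \<Sum>j<N. (cmod (\<Sum>E\<in>S. cis (- (T j * E)) * (z E * app n (\<kappa> l) (A E) a)))\<^sup>2)"
    by (intro sum.cong refl sum.swap)
  also have "\<dots> = (\<Sum>l<R. \<Sum>a<m. real N * (\<Sum>E\<in>S. (cmod (z E * app n (\<kappa> l) (A E) a))\<^sup>2))"
    by (intro sum.cong refl Parseval_times S T)
  also have "\<dots> = real N * (\<Sum>l<R. \<Sum>a<m. \<Sum>E\<in>S. (cmod (z E))\<^sup>2 * (cmod (app n (\<kappa> l) (A E) a))\<^sup>2)"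
    by (simp add: sum_distrib_left norm_mult power_mult_distrib)
  also have "(\<Sum>l<R. \<Sum>a<m. \<Sum>E\<in>S. (cmod (z E))\<^sup>2 * (cmod (app n (\<kappa> l) (A E) a))\<^sup>2)
      = (\<Sum>l<R. \<Sum>E\<in>S. \<Sum>a<m. (cmod (z E))\<^sup>2 * (cmod (app n (\<kappa> l) (A E) a))\<^sup>2)"
    by (intro sum.cong refl sum.swap)
  also have "\<dots> = (\<Sum>E\<in>S. \<Sum>l<R. \<Sum>a<m. (cmod (z E))\<^sup>2 * (cmod (app n (\<kappa> l) (A E) a))\<^sup>2)"
    by (rule sum.swap)
  also have "\<dots> = (\<Sum>E\<in>S. (cmod (z E))\<^sup>2 * yield_norm n m R \<kappa> (A E))"
    by (simp add: yield_norm_def sqn_def sum_distrib_left)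
  finally show ?thesis .
qed

lemma cmod_cis_minus_one_le: "cmod (cis x - 1) \<le> \<bar>x\<bar>"
proof -
  have "(cmod (cis x - 1))\<^sup>2 = 4 * (sin (x / 2))\<^sup>2"
  proof -
    have "(cmod (cis x - 1))\<^sup>2 = (cos x - 1)\<^sup>2 + (sin x)\<^sup>2" by (simp add: cmod_power2)
    also have "\<dots> = 2 - 2 * cos x"
      using sin_cos_squared_add[of x] by (simp add: power2_eq_square algebra_simps)
    finally show ?thesis using cos_double_sin[of "x / 2"] by simp
  qed
  also have "\<dots> \<le> 4 * (x / 2)\<^sup>2"
    using abs_sin_x_le_abs_x[of "x / 2"] by (intro mult_left_mono) (simp_all add: abs_le_square_iff[symmetric])
  finally have "(cmod (cis x - 1))\<^sup>2 \<le> \<bar>x\<bar>\<^sup>2" by (simp add: power_divide)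
  then show ?thesis using abs_ge_zero power2_le_imp_le by blast
qed

text \<open>The hypothesis \<open>fid\<close> is summed over the shifts \<open>real k * h\<close>
  and the averaging times. The window part \<open>a\<close> at the shifted time is replaced by
  \<open>a t\<close> up to a phase, so that one vector faces \<open>K\<close> targets. By Parseval
  the error of this replacement is a small multiple of the mean yield \<open>m0\<close> itself; only
  the tail weight \<open>\<beta>\<close> is divided by \<open>p0\<close>. Two uses of
  \<open>overlap_add\<close> give the coefficients 4, 4 and 2.\<close>

lemma fidelity_bound:
  fixes A \<phi> f :: "real \<Rightarrow> nat \<Rightarrow> complex" and F :: real
  assumes S: "finite S" and K: "0 < K" and h: "0 \<le> h" and L: "0 \<le> L" and \<theta>: "0 \<le> \<theta>" and p0: "0 < p0"
    and contr: "\<And>u. yield_norm n m R \<kappa> u \<le> sqn n u"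
    and f: "\<And>t i. i < n \<Longrightarrow> f t i = (\<Sum>E\<in>S. cis (- (t * E)) * A E i)"
    and unit: "\<And>t. sqn m (\<phi> t) = 1"
    and ortho: "\<And>t k l. k < K \<Longrightarrow> l < K \<Longrightarrow> k \<noteq> l \<Longrightarrow>
      cmod (ip m (\<phi> (t + real k * h)) (\<phi> (t + real l * h))) \<le> \<theta>"
    and fid: "\<And>t. F * yield_norm n m R \<kappa> (f t) \<le> overlap n m R \<kappa> (\<phi> t) (f t)"
    and success: "\<And>t. p0 \<le> yield_norm n m R \<kappa> (f t)"
    and tail: "(\<Sum>E\<in>{E\<in>S. \<bar>E - E0\<bar> > L}. sqn n (A E)) \<le> \<beta>"
  shows "F \<le> 4 / real K + 4 * \<theta> + 4 * (real K * h * L)\<^sup>2 + 2 * \<beta> / p0"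
proof -
  let ?Y = "yield_norm n m R \<kappa>" and ?O = "overlap n m R \<kappa>"
  define W where "W = {E\<in>S. \<bar>E - E0\<bar> \<le> L}"
  define V where "V = {E\<in>S. \<bar>E - E0\<bar> > L}"
  have fin: "finite W" "finite V" and SWV: "S = W \<union> V" "W \<inter> V = {}" "W \<subseteq> S" "V \<subseteq> S"
    using S by (auto simp: W_def V_def)
  define a where "a t i = (\<Sum>E\<in>W. cis (- (t * E)) * A E i)" for t i
  define b where "b t i = (\<Sum>E\<in>V. cis (- (t * E)) * A E i)" for t i
  \<comment> \<open>This is the mean yield over the averaging times, the same for every time shift,
    as \<open>mean_f\<close> shows.\<close>
  define m0 where "m0 = (\<Sum>E\<in>S. ?Y (A E))"
  \<comment> \<open>The phase \<open>cis (s * E0)\<close> recentres the window at zero, so that each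
    component of the difference carries a factor of modulus at most
    \<open>\<bar>s * L\<bar>\<close>. The form \<open>+ - 1 *\<close> lets the two sums merge by
    distributivity.\<close>
  define \<Delta> where "\<Delta> t s i = cis (s * E0) * a (t + s) i + - 1 * a t i" for t s i
  let ?D = "(\<lambda>(E, F). E - F) ` ((S \<times> S) - Id)"
  have "finite ?D" "0 \<notin> ?D" using S by auto
  from annihilating_times[OF this] obtain N :: nat and T where
    N: "0 < N" and T0: "\<forall>s\<in>?D. (\<Sum>k<N. cis (T k * s)) = 0" by blast
  have T: "(\<Sum>j<N. cis (T j * (E - F))) = 0" if "E \<in> S" "F \<in> S" "E \<noteq> F" for E F
    using T0 that by force
  have Pars: "(\<Sum>j<N. ?Y (\<lambda>i. \<Sum>E\<in>S'. cis (- (T j * E)) * (z E * A E i)))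
      = real N * (\<Sum>E\<in>S'. (cmod (z E))\<^sup>2 * ?Y (A E))" if "S' \<subseteq> S" for S' z
    using finite_subset[OF that S] T that by (intro yield_norm_Parseval) auto
  have shift: "cis (- ((t + s) * E)) * z = cis (- (t * E)) * (cis (- (s * E)) * z)" for t s E z
    by (simp add: cis_mult algebra_simps flip: mult.assoc)
  have mean_f: "(\<Sum>j<N. ?Y (f (T j + s))) = real N * m0" for s
  proof -
    have "?Y (f (T j + s)) = ?Y (\<lambda>i. \<Sum>E\<in>S. cis (- (T j * E)) * (cis (- (s * E)) * A E i))" for j
      unfolding yield_norm_def by (intro sum.cong refl arg_cong[of _ _ "sqn m"] app_cong) (simp add: f shift)
    then show ?thesis using Pars[of S "\<lambda>E. cis (- (s * E))"] by (simp add: m0_def)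
  qed
  have mean_a: "(\<Sum>j<N. ?Y (a (T j))) \<le> real N * m0"
  proof -
    have "(\<Sum>j<N. ?Y (a (T j))) = real N * (\<Sum>E\<in>W. ?Y (A E))"
      using Pars[OF SWV(3), of "\<lambda>_. 1"] by (simp add: a_def[abs_def])
    also have "\<dots> \<le> real N * m0"
      unfolding m0_def using S SWV(3) by (intro mult_left_mono sum_mono2) (auto simp: yield_norm_nonneg)
    finally show ?thesis .
  qed
  have mean_b: "(\<Sum>j<N. ?Y (b (T j + s))) \<le> real N * \<beta>" for s
  proof -
    have "(\<Sum>j<N. ?Y (b (T j + s))) = real N * (\<Sum>E\<in>V. ?Y (A E))"
      using Pars[OF SWV(4), of "\<lambda>E. cis (- (s * E))"] by (simp add: b_def[abs_def] shift)
    also have "\<dots> \<le> real N * (\<Sum>E\<in>V. sqn n (A E))"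
      by (intro mult_left_mono sum_mono contr) simp
    also have "\<dots> \<le> real N * \<beta>" using tail by (simp add: V_def mult_left_mono)
    finally show ?thesis .
  qed
  have mean_\<Delta>: "(\<Sum>j<N. ?Y (\<Delta> (T j) s)) \<le> real N * ((s * L)\<^sup>2 * m0)" for s
  proof -
    let ?z = "\<lambda>E. cis (- (s * (E - E0))) - 1"
    have "\<Delta> t s i = (\<Sum>E\<in>W. cis (- (t * E)) * (?z E * A E i))" for t i
      unfolding \<Delta>_def a_def sum_distrib_left sum.distrib[symmetric]
      by (intro sum.cong refl) (simp add: shift algebra_simps cis_mult flip: mult.assoc)
    then have "\<Delta> t s = (\<lambda>i. \<Sum>E\<in>W. cis (- (t * E)) * (?z E * A E i))" for t by blast
    then have "(\<Sum>j<N. ?Y (\<Delta> (T j) s)) = real N * (\<Sum>E\<in>W. (cmod (?z E))\<^sup>2 * ?Y (A E))"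
      using Pars[OF SWV(3), of ?z] by simp
    also have "\<dots> \<le> real N * (\<Sum>E\<in>W. (s * L)\<^sup>2 * ?Y (A E))"
    proof (intro mult_left_mono sum_mono mult_right_mono)
      fix E assume "E \<in> W"
      then have "\<bar>E - E0\<bar> \<le> L" by (simp add: W_def)
      have "cmod (?z E) \<le> \<bar>- (s * (E - E0))\<bar>" by (rule cmod_cis_minus_one_le)
      also have "\<dots> \<le> \<bar>s * L\<bar>" using \<open>\<bar>E - E0\<bar> \<le> L\<close> L by (simp add: abs_mult mult_left_mono)
      finally have "(cmod (?z E))\<^sup>2 \<le> \<bar>s * L\<bar>\<^sup>2" by (intro power_mono) auto
      then show "(cmod (?z E))\<^sup>2 \<le> (s * L)\<^sup>2" by simp
    qed (simp_all add: yield_norm_nonneg)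
    also have "\<dots> \<le> real N * (\<Sum>E\<in>S. (s * L)\<^sup>2 * ?Y (A E))"
      using S SWV(3) by (intro mult_left_mono sum_mono2) (auto simp: yield_norm_nonneg)
    finally show ?thesis by (simp add: m0_def sum_distrib_left)
  qed
  have "real N * p0 = (\<Sum>j<N. p0)" by simp
  also have "\<dots> \<le> (\<Sum>j<N. ?Y (f (T j + 0)))" by (intro sum_mono success)
  also have "\<dots> = real N * m0" by (rule mean_f)
  finally have m0: "p0 \<le> m0" using N by simp
  \<comment> \<open>Only the overlap of \<open>a t\<close> is kept for Bessel's inequality; the
    overlaps of \<open>\<Delta>\<close> and \<open>b\<close> are bounded by their yields.\<close>
  have point: "F * ?Y (f (t + s)) \<le> 4 * ?O (\<phi> (t + s)) (a t) + 4 * ?Y (\<Delta> t s) + 2 * ?Y (b (t + s))" for t s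
  proof -
    let ?w = "\<phi> (t + s)"
    have "f (t + s) i = a (t + s) i + b (t + s) i" if "i < n" for i
      using fin SWV(1,2) that by (simp add: f a_def b_def sum.union_disjoint)
    then have "app n k (f (t + s)) = app n k (\<lambda>i. a (t + s) i + b (t + s) i)" for k by (rule app_cong)
    then have "?O ?w (f (t + s)) = ?O ?w (\<lambda>i. a (t + s) i + b (t + s) i)" by (simp add: overlap_def)
    also have "\<dots> \<le> 2 * ?O ?w (a (t + s)) + 2 * ?O ?w (b (t + s))" by (rule overlap_add)
    also have "?O ?w (b (t + s)) \<le> ?Y (b (t + s))" by (rule overlap_le[OF unit])
    also have "?O ?w (a (t + s)) = ?O ?w (\<lambda>i. cis (s * E0) * a (t + s) i)"
      by (simp add: overlap_phase)
    also have "(\<lambda>i. cis (s * E0) * a (t + s) i) = (\<lambda>i. a t i + \<Delta> t s i)"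
      by (simp add: \<Delta>_def fun_eq_iff)
    also have "?O ?w (\<lambda>i. a t i + \<Delta> t s i) \<le> 2 * ?O ?w (a t) + 2 * ?O ?w (\<Delta> t s)" by (rule overlap_add)
    also have "?O ?w (\<Delta> t s) \<le> ?Y (\<Delta> t s)" by (rule overlap_le[OF unit])
    finally show ?thesis using fid[of "t + s"] by simp
  qed
  have "real N * (real K * (F * m0)) = (\<Sum>k<K. F * (\<Sum>j<N. ?Y (f (T j + real k * h))))"
    by (simp add: mean_f)
  also have "\<dots> \<le> (\<Sum>k<K. \<Sum>j<N. 4 * ?O (\<phi> (T j + real k * h)) (a (T j))
      + 4 * ?Y (\<Delta> (T j) (real k * h)) + 2 * ?Y (b (T j + real k * h)))"
    unfolding sum_distrib_left by (intro sum_mono point)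
  also have "\<dots> = 4 * (\<Sum>j<N. \<Sum>k<K. ?O (\<phi> (T j + real k * h)) (a (T j)))
      + 4 * (\<Sum>k<K. \<Sum>j<N. ?Y (\<Delta> (T j) (real k * h))) + 2 * (\<Sum>k<K. \<Sum>j<N. ?Y (b (T j + real k * h)))"
    unfolding sum.distrib sum_distrib_left
    by (subst sum.swap[of "\<lambda>k j. 4 * ?O (\<phi> (T j + real k * h)) (a (T j))"]) simp
  also have "\<dots> \<le> 4 * (\<Sum>j<N. (1 + real K * \<theta>) * ?Y (a (T j)))
      + 4 * (\<Sum>k<K. real N * ((real K * h * L)\<^sup>2 * m0)) + 2 * (\<Sum>k<K. real N * \<beta>)"
  proof (intro add_mono mult_left_mono sum_mono mean_b sum_overlap_le)
    fix k assume "k \<in> {..<K}"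
    then have "(real k * h * L)\<^sup>2 \<le> (real K * h * L)\<^sup>2"
      using h L by (intro power_mono mult_right_mono) auto
    then have "(real k * h * L)\<^sup>2 * m0 \<le> (real K * h * L)\<^sup>2 * m0"
      using m0 p0 by (intro mult_right_mono) auto
    then have "real N * ((real k * h * L)\<^sup>2 * m0) \<le> real N * ((real K * h * L)\<^sup>2 * m0)"
      by (intro mult_left_mono) auto
    with mean_\<Delta>[of "real k * h"]
    show "(\<Sum>j<N. ?Y (\<Delta> (T j) (real k * h))) \<le> real N * ((real K * h * L)\<^sup>2 * m0)" by linarith
  qed (use unit \<theta> ortho in auto)
  also have "(\<Sum>j<N. (1 + real K * \<theta>) * ?Y (a (T j))) \<le> (1 + real K * \<theta>) * (real N * m0)"
    unfolding sum_distrib_left[symmetric] using \<theta> by (intro mult_left_mono mean_a) auto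
  finally have "real N * (real K * (F * m0)) \<le>
      real N * (4 * ((1 + real K * \<theta>) * m0) + 4 * (real K * ((real K * h * L)\<^sup>2 * m0)) + 2 * (real K * \<beta>))"
    by (simp add: algebra_simps)
  then have "real K * (F * m0) \<le> 4 * ((1 + real K * \<theta>) * m0) + 4 * (real K * ((real K * h * L)\<^sup>2 * m0)) + 2 * (real K * \<beta>)"
    using N by simp
  then have "F \<le> 4 / real K + 4 * \<theta> + 4 * (real K * h * L)\<^sup>2 + 2 * \<beta> / m0"
    using K m0 p0 by (simp add: field_simps)
  also have "2 * \<beta> / m0 \<le> 2 * \<beta> / p0"
  proof (rule divide_left_mono[OF m0])
    have "0 \<le> \<beta>" using sum_nonneg[of V "\<lambda>E. sqn n (A E)"] tail by (simp add: V_def)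
    then show "0 \<le> 2 * \<beta>" by simp
  qed (use m0 p0 in simp)
  finally show ?thesis by simp
qed

subsection \<open>Spectral decomposition of the clock states\<close>

text \<open>Components are indexed by their eigenvalue and may be zero, which makes the notion
  stable under sums and multiples.\<close>

definition eigen_sum :: "nat \<Rightarrow> (nat \<Rightarrow> nat \<Rightarrow> complex) \<Rightarrow> (nat \<Rightarrow> complex) \<Rightarrow> bool" where
  "eigen_sum d h u \<longleftrightarrow> (\<exists>S A. finite S \<and> (\<forall>e\<in>S. \<forall>i<d. app d h (A e) i = e * A e i) \<and>
     (\<forall>i<d. u i = (\<Sum>e\<in>S. A e i)))"

lemma eigen_sum_single: "(\<And>i. i < d \<Longrightarrow> app d h u i = e * u i) \<Longrightarrow> eigen_sum d h u"
  unfolding eigen_sum_def by (intro exI[of _ "{e}"] exI[of _ "\<lambda>_. u"]) simp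

lemma eigen_sum_cong: "(\<And>i. i < d \<Longrightarrow> u i = v i) \<Longrightarrow> eigen_sum d h u \<Longrightarrow> eigen_sum d h v"
  by (simp add: eigen_sum_def)

lemma eigen_sum_add:
  assumes "eigen_sum d h u" "eigen_sum d h v"
  shows "eigen_sum d h (\<lambda>i. u i + v i)"
proof -
  obtain S A where A: "finite S" "\<forall>e\<in>S. \<forall>i<d. app d h (A e) i = e * A e i"
    "\<forall>i<d. u i = (\<Sum>e\<in>S. A e i)" using assms(1) by (auto simp: eigen_sum_def)
  obtain T B where B: "finite T" "\<forall>e\<in>T. \<forall>i<d. app d h (B e) i = e * B e i"
    "\<forall>i<d. v i = (\<Sum>e\<in>T. B e i)" using assms(2) by (auto simp: eigen_sum_def)
  define C where "C e i = (if e \<in> S then 1 else 0) * A e i + (if e \<in> T then 1 else 0) * B e i" for e i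
  have "app d h (C e) i = e * C e i" if "e \<in> S \<union> T" "i < d" for e i
    using A(2) B(2) that unfolding C_def app_add app_scale by (auto simp: algebra_simps)
  moreover have "u i + v i = (\<Sum>e\<in>S \<union> T. C e i)" if "i < d" for i
  proof -
    have "(\<Sum>e\<in>S \<union> T. (if e \<in> S then 1 else 0) * A e i) = (\<Sum>e\<in>S. A e i)"
      using A(1) B(1) by (intro sum.mono_neutral_cong_right) auto
    moreover have "(\<Sum>e\<in>S \<union> T. (if e \<in> T then 1 else 0) * B e i) = (\<Sum>e\<in>T. B e i)"
      using A(1) B(1) by (intro sum.mono_neutral_cong_right) auto
    ultimately show ?thesis using A(3) B(3) that by (simp add: C_def sum.distrib)
  qed
  ultimately show ?thesis
    using A(1) B(1) unfolding eigen_sum_def by (intro exI[of _ "S \<union> T"] exI[of _ C]) auto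
qed

lemma eigen_sum_scale: "eigen_sum d h u \<Longrightarrow> eigen_sum d h (\<lambda>i. c * u i)"
proof -
  assume "eigen_sum d h u"
  then obtain S A where A: "finite S" "\<forall>e\<in>S. \<forall>i<d. app d h (A e) i = e * A e i"
    "\<forall>i<d. u i = (\<Sum>e\<in>S. A e i)" by (auto simp: eigen_sum_def)
  then show ?thesis
    unfolding eigen_sum_def
    by (intro exI[of _ S] exI[of _ "\<lambda>e i. c * A e i"]) (auto simp: app_scale sum_distrib_left)
qed

lemma eigen_sum_sum:
  "finite J \<Longrightarrow> (\<And>j. j \<in> J \<Longrightarrow> eigen_sum d h (u j)) \<Longrightarrow> eigen_sum d h (\<lambda>i. \<Sum>j\<in>J. u j i)"
proof (induction J rule: finite_induct)
  case empty
  then show ?case by (auto intro!: eigen_sum_single[of _ _ _ 0] simp: app_def)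
next
  case (insert j J)
  then show ?case using eigen_sum_add[of d h "u j" "\<lambda>i. \<Sum>j\<in>J. u j i"] by simp
qed

lemma ip_app_hermitian:
  assumes "\<And>i j. i < d \<Longrightarrow> j < d \<Longrightarrow> h j i = cnj (h i j)"
  shows "ip d (app d h u) v = ip d u (app d h v)"
proof -
  have "ip d (app d h u) v = (\<Sum>i<d. \<Sum>j<d. h i j * u j * cnj (v i))"
    by (simp add: ip_def app_def sum_distrib_right)
  also have "\<dots> = (\<Sum>j<d. \<Sum>i<d. h i j * u j * cnj (v i))" by (rule sum.swap)
  also have "\<dots> = (\<Sum>j<d. \<Sum>i<d. u j * cnj (h j i * v i))"
  proof (intro sum.cong refl)
    fix i j assume "i \<in> {..<d}" "j \<in> {..<d}"
    then have "h i j = cnj (h j i)" by (intro assms) auto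
    then show "h i j * u j * cnj (v i) = u j * cnj (h j i * v i)" by simp
  qed
  also have "\<dots> = ip d u (app d h v)" by (simp add: ip_def app_def sum_distrib_left)
  finally show ?thesis .
qed

lemma ip_cong: "(\<And>i. i < n \<Longrightarrow> u i = u' i) \<Longrightarrow> (\<And>i. i < n \<Longrightarrow> v i = v' i) \<Longrightarrow> ip n u v = ip n u' v'"
  by (simp add: ip_def)

lemma ip_scale_right: "ip m u (\<lambda>i. c * w i) = cnj c * ip m u w"
  by (simp add: ip_def sum_distrib_left mult_ac)

lemma sqn_eq_0: "sqn n u = 0 \<Longrightarrow> i < n \<Longrightarrow> u i = 0"
  by (simp add: sqn_def sum_nonneg_eq_0_iff)

lemma hermitian_eigenvalue_real:
  assumes herm: "\<And>i j. i < d \<Longrightarrow> j < d \<Longrightarrow> h j i = cnj (h i j)"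
    and eig: "\<And>i. i < d \<Longrightarrow> app d h u i = e * u i" and nz: "sqn d u \<noteq> 0"
  shows "cnj e = e"
proof -
  have "e * ip d u u = ip d (app d h u) u"
    using eig by (simp add: ip_cong[of d "app d h u" "\<lambda>i. e * u i"] ip_scale_left)
  also have "\<dots> = ip d u (app d h u)" by (rule ip_app_hermitian[OF herm])
  also have "\<dots> = cnj e * ip d u u"
    using eig by (simp add: ip_cong[of d u u "app d h u" "\<lambda>i. e * u i"] ip_scale_right)
  finally show ?thesis using nz by (simp add: ip_self)
qed

lemma hermitian_eigen_orthogonal:
  assumes herm: "\<And>i j. i < d \<Longrightarrow> j < d \<Longrightarrow> h j i = cnj (h i j)"
    and u: "\<And>i. i < d \<Longrightarrow> app d h u i = e * u i" and v: "\<And>i. i < d \<Longrightarrow> app d h v i = f * v i"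
    and ne: "e \<noteq> cnj f"
  shows "ip d u v = 0"
proof -
  have "e * ip d u v = ip d (app d h u) v"
    using u by (simp add: ip_cong[of d "app d h u" "\<lambda>i. e * u i"] ip_scale_left)
  also have "\<dots> = ip d u (app d h v)" by (rule ip_app_hermitian[OF herm])
  also have "\<dots> = cnj f * ip d u v"
    using v by (simp add: ip_cong[of d u u "app d h v" "\<lambda>i. f * v i"] ip_scale_right)
  finally show ?thesis using ne by simp
qed

text \<open>
  For Hermitian \<open>h\<close> there are no Jordan chains: if \<open>z = (h - \<mu>) v'\<close> is in the kernel of \<open>h - \<mu>\<close>,
  then \<open>\<parallel>z\<parallel>\<^sup>2 = \<langle>v', (h - \<mu>) z\<rangle> = 0\<close>.
\<close>

lemma eigen_sum_step:
  assumes herm: "\<And>i j. i < d \<Longrightarrow> j < d \<Longrightarrow> h j i = cnj (h i j)"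
    and w: "eigen_sum d h (\<lambda>i. app d h v i - \<mu> * v i)"
  shows "eigen_sum d h v"
proof -
  from w obtain S A where S: "finite S" and A: "\<And>e i. e \<in> S \<Longrightarrow> i < d \<Longrightarrow> app d h (A e) i = e * A e i"
    and sum: "\<And>i. i < d \<Longrightarrow> app d h v i - \<mu> * v i = (\<Sum>e\<in>S. A e i)" by (auto simp: eigen_sum_def)
  \<comment> \<open>The operator \<open>h - \<mu>\<close> is inverted on the components with
    \<open>e \<noteq> \<mu>\<close>. Once \<open>r\<close> is subtracted from \<open>v\<close>, only
    the component \<open>z\<close> at \<open>\<mu>\<close> itself remains on the right-hand
    side.\<close>
  define r where "r i = (\<Sum>e\<in>S - {\<mu>}. 1 / (e - \<mu>) * A e i)" for i
  define v' where "v' i = v i + - 1 * r i" for i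
  define z where "z i = (if \<mu> \<in> S then 1 else 0) * A \<mu> i" for i
  have r: "eigen_sum d h r" unfolding r_def
    using S A by (intro eigen_sum_sum eigen_sum_scale eigen_sum_single) auto
  have hr: "app d h r i - \<mu> * r i = (\<Sum>e\<in>S - {\<mu>}. A e i)" if "i < d" for i
  proof -
    have "app d h r i - \<mu> * r i = (\<Sum>e\<in>S - {\<mu>}. 1 / (e - \<mu>) * (e * A e i) - \<mu> * (1 / (e - \<mu>) * A e i))"
      using A that unfolding r_def app_sum by (simp add: sum_subtractf sum_distrib_left)
    also have "\<dots> = (\<Sum>e\<in>S - {\<mu>}. A e i)"
      by (intro sum.cong refl) (auto simp: divide_simps, auto simp: algebra_simps)
    finally show ?thesis .
  qed
  have hv': "app d h v' i - \<mu> * v' i = z i" if "i < d" for i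
  proof -
    have "app d h v' i - \<mu> * v' i = (app d h v i - \<mu> * v i) - (app d h r i - \<mu> * r i)"
      unfolding v'_def app_add app_scale by (simp add: algebra_simps)
    also have "\<dots> = z i" unfolding sum[OF that] hr[OF that]
      using S by (cases "\<mu> \<in> S") (simp_all add: z_def sum.remove[of S \<mu>])
    finally show ?thesis .
  qed
  have hz: "app d h z i = \<mu> * z i" if "i < d" for i
    using A[of \<mu> i] that unfolding z_def app_scale by auto
  have "sqn d z = 0"
  proof (rule ccontr)
    assume nz: "sqn d z \<noteq> 0"
    have real: "cnj \<mu> = \<mu>" by (rule hermitian_eigenvalue_real[OF herm hz nz])
    have "ip d z z = ip d (\<lambda>i. app d h v' i + - \<mu> * v' i) z"
      by (rule ip_cong) (simp_all add: hv'[symmetric])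
    also have "\<dots> = ip d (app d h v') z - \<mu> * ip d v' z" by (simp only: ip_add_left ip_scale_left) simp
    also have "ip d (app d h v') z = ip d v' (app d h z)" by (rule ip_app_hermitian[OF herm])
    also have "\<dots> = ip d v' (\<lambda>i. \<mu> * z i)" by (rule ip_cong) (simp_all add: hz)
    also have "\<dots> = \<mu> * ip d v' z" by (simp add: ip_scale_right real)
    finally show False using nz by (simp add: ip_self)
  qed
  then have "z i = 0" if "i < d" for i using that by (rule sqn_eq_0)
  then have "eigen_sum d h v'" using hv' by (intro eigen_sum_single[of _ _ _ \<mu>]) simp
  from eigen_sum_add[OF this r] show ?thesis by (simp add: v'_def)
qed

text \<open>In a Schur triangularisation \<open>H * P = P * B\<close>, applying
  \<open>H - B $$ (j, j)\<close> to column \<open>j\<close> of \<open>P\<close> gives a combination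
  of earlier columns, so induction with \<open>eigen_sum_step\<close> covers every column. Any
  \<open>v\<close> is a combination of columns with coefficients
  \<open>Q *\<^sub>v vec d v\<close>.\<close>

lemma eigen_sum_hermitian:
  assumes H: "H \<in> carrier_mat d d" and herm: "\<And>i j. i < d \<Longrightarrow> j < d \<Longrightarrow> H $$ (j, i) = cnj (H $$ (i, j))"
  shows "eigen_sum d (\<lambda>i j. H $$ (i, j)) v"
proof -
  let ?h = "\<lambda>i j. H $$ (i, j)"
  obtain es where "char_poly H = (\<Prod>e\<leftarrow>es. [:- e, 1:])" using char_poly_factorized[OF H] by auto
  from schur_decomposition_exists[OF H this] obtain B where
    B: "B \<in> carrier_mat d d" "upper_triangular B" "similar_mat H B" by blast
  then obtain P Q where wit: "similar_mat_wit H B P Q" by (auto simp: similar_mat_def)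
  note PQ = similar_mat_witD2[OF H wit]
  have P: "P \<in> carrier_mat d d" and Q: "Q \<in> carrier_mat d d" using PQ by auto
  have "H * P = P * B * (Q * P)" using PQ H P Q B by (simp add: assoc_mult_mat[of _ d d _ d _ d])
  then have HP: "H * P = P * B" using PQ P B by simp
  have col: "eigen_sum d ?h (\<lambda>i. P $$ (i, j))" if "j < d" for j
    using that
  proof (induction j rule: less_induct)
    case (less j)
    have step: "app d ?h (\<lambda>i. P $$ (i, j)) i - B $$ (j, j) * P $$ (i, j) = (\<Sum>k<j. B $$ (k, j) * P $$ (i, k))"
      if i: "i < d" for i
    proof -
      have "app d ?h (\<lambda>i. P $$ (i, j)) i = (H * P) $$ (i, j)"
        using H P i less.prems by (simp add: app_def scalar_prod_def atLeast0LessThan)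
      also have "\<dots> = (\<Sum>k<d. P $$ (i, k) * B $$ (k, j))"
        unfolding HP using P B i less.prems by (simp add: scalar_prod_def atLeast0LessThan)
      also have "\<dots> = (\<Sum>k<Suc j. P $$ (i, k) * B $$ (k, j))"
        using B less.prems by (intro sum.mono_neutral_right) (auto simp: upper_triangular_def)
      finally show ?thesis by (simp add: mult.commute)
    qed
    have s: "eigen_sum d ?h (\<lambda>i. \<Sum>k<j. B $$ (k, j) * P $$ (i, k))"
      using less by (intro eigen_sum_sum eigen_sum_scale) auto
    have "eigen_sum d ?h (\<lambda>i. app d ?h (\<lambda>i. P $$ (i, j)) i - B $$ (j, j) * P $$ (i, j))"
      by (rule eigen_sum_cong[OF _ s]) (simp only: step)
    then show ?case by (rule eigen_sum_step[rotated]) (rule herm)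
  qed
  let ?v = "vec d v"
  have "eigen_sum d ?h (\<lambda>i. \<Sum>j<d. (Q *\<^sub>v ?v) $ j * P $$ (i, j))"
    using col by (intro eigen_sum_sum eigen_sum_scale) auto
  moreover have "(\<Sum>j<d. (Q *\<^sub>v ?v) $ j * P $$ (i, j)) = v i" if "i < d" for i
  proof -
    have Qv: "Q *\<^sub>v ?v \<in> carrier_vec d" using Q by (rule mult_mat_vec_carrier) simp
    have "(\<Sum>j<d. (Q *\<^sub>v ?v) $ j * P $$ (i, j)) = (P *\<^sub>v (Q *\<^sub>v ?v)) $ i"
      by (subst mult_mat_vec_index[OF P Qv that]) (simp add: mult.commute)
    also have "P *\<^sub>v (Q *\<^sub>v ?v) = (P * Q) *\<^sub>v ?v" using P Q by (simp add: assoc_mult_mat_vec[of _ d d])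
    also have "\<dots> $ i = v i" using PQ that by simp
    finally show ?thesis .
  qed
  ultimately show ?thesis by (rule eigen_sum_cong[rotated])
qed

section \<open>The matrix exponential on eigenvectors\<close>

lemma pow_mat_eigen:
  assumes B: "B \<in> carrier_mat d d"
    and eig: "\<And>i. i < d \<Longrightarrow> app d (\<lambda>i j. B $$ (i, j)) u i = e * u i" and i: "i < d"
  shows "(\<Sum>j<d. (B ^\<^sub>m k) $$ (i, j) * u j) = e ^ k * u i"
proof (induction k)
  case 0
  have "(\<Sum>j<d. (B ^\<^sub>m 0) $$ (i, j) * u j) = (\<Sum>j<d. if j = i then u j else 0)"
    using B i by (intro sum.cong) auto
  then show ?case using i by simp
next
  case (Suc k)
  have "(\<Sum>j<d. (B ^\<^sub>m Suc k) $$ (i, j) * u j) = (\<Sum>j<d. \<Sum>l<d. (B ^\<^sub>m k) $$ (i, l) * B $$ (l, j) * u j)"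
    using B i by (intro sum.cong refl) (simp add: scalar_prod_def atLeast0LessThan sum_distrib_right)
  also have "\<dots> = (\<Sum>l<d. \<Sum>j<d. (B ^\<^sub>m k) $$ (i, l) * B $$ (l, j) * u j)" by (rule sum.swap)
  also have "\<dots> = (\<Sum>l<d. (B ^\<^sub>m k) $$ (i, l) * app d (\<lambda>i j. B $$ (i, j)) u l)"
    by (simp add: app_def sum_distrib_left mult.assoc)
  also have "\<dots> = e * (\<Sum>l<d. (B ^\<^sub>m k) $$ (i, l) * u l)"
    by (simp add: eig sum_distrib_left mult_ac)
  finally show ?case by (simp add: Suc)
qed

lemma pow_mat_entry_bound:
  assumes B: "B \<in> carrier_mat d d" and C: "\<And>i j. i < d \<Longrightarrow> j < d \<Longrightarrow> cmod (B $$ (i, j)) \<le> C"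
    and ij: "i < d" "j < d"
  shows "cmod ((B ^\<^sub>m k) $$ (i, j)) \<le> (real d * C) ^ k"
  using ij(2)
proof (induction k arbitrary: j)
  case 0
  then show ?case using B ij by simp
next
  case (Suc k)
  have C0: "0 \<le> C" using order_trans[OF norm_ge_zero C[OF ij(1) Suc.prems]] .
  have "cmod ((B ^\<^sub>m Suc k) $$ (i, j)) = cmod (\<Sum>l<d. (B ^\<^sub>m k) $$ (i, l) * B $$ (l, j))"
    using B ij Suc.prems by (simp add: scalar_prod_def atLeast0LessThan)
  also have "\<dots> \<le> (\<Sum>l<d. (real d * C) ^ k * C)"
    unfolding norm_mult
    by (intro order_trans[OF norm_sum] sum_mono, unfold norm_mult, intro mult_mono)
      (use Suc C C0 in auto)
  finally show ?case by (simp add: mult_ac)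
qed

text \<open>Convergence is what allows the series in \<open>mat_exp\<close> to be summed termwise
  against a vector. The entries of the powers are dominated by the terms of a scalar exponential
  series.\<close>

lemma summable_mat_exp:
  fixes B :: "complex mat"
  assumes B: "B \<in> carrier_mat d d" and ij: "i < d" "j < d"
  shows "summable (\<lambda>k. (B ^\<^sub>m k) $$ (i, j) / fact k)"
proof -
  define C where "C = Max ((\<lambda>(i, j). cmod (B $$ (i, j))) ` ({..<d} \<times> {..<d}))"
  have C: "cmod (B $$ (i, j)) \<le> C" if "i < d" "j < d" for i j
    unfolding C_def using that by (intro Max_ge) force+
  show ?thesis
  proof (rule summable_comparison_test')
    show "summable (\<lambda>k. inverse (fact k) * (real d * C) ^ k)" by (rule summable_exp)
    show "norm ((B ^\<^sub>m k) $$ (i, j) / fact k) \<le> inverse (fact k) * (real d * C) ^ k" for k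
      using pow_mat_entry_bound[OF B C ij, of k]
      by (simp add: norm_mult norm_inverse divide_inverse mult.commute mult_left_mono)
  qed
qed

lemma mat_exp_eigen:
  assumes B: "B \<in> carrier_mat d d"
    and eig: "\<And>i. i < d \<Longrightarrow> app d (\<lambda>i j. B $$ (i, j)) u i = e * u i" and i: "i < d"
  shows "(\<Sum>j<d. mat_exp B $$ (i, j) * u j) = exp e * u i"
proof -
  have "(\<Sum>j<d. mat_exp B $$ (i, j) * u j) = (\<Sum>j<d. \<Sum>k. (B ^\<^sub>m k) $$ (i, j) / fact k * u j)"
    using B i by (intro sum.cong refl) (simp add: mat_exp_def suminf_mult2 summable_mat_exp)
  also have "\<dots> = (\<Sum>k. \<Sum>j<d. (B ^\<^sub>m k) $$ (i, j) / fact k * u j)"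
    using B i by (intro suminf_sum[symmetric] summable_mult2 summable_mat_exp) auto
  also have "\<dots> = (\<Sum>k. e ^ k /\<^sub>R fact k * u i)"
  proof (intro suminf_cong)
    fix k
    have "(\<Sum>j<d. (B ^\<^sub>m k) $$ (i, j) / fact k * u j) = (\<Sum>j<d. (B ^\<^sub>m k) $$ (i, j) * u j) / fact k"
      by (simp add: sum_divide_distrib)
    also have "\<dots> = e ^ k * u i / fact k" by (simp only: pow_mat_eigen[OF B eig i])
    also have "\<dots> = e ^ k /\<^sub>R fact k * u i" by (simp add: scaleR_conv_of_real divide_inverse mult_ac)
    finally show "(\<Sum>j<d. (B ^\<^sub>m k) $$ (i, j) / fact k * u j) = \<dots>" .
  qed
  also have "\<dots> = exp e * u i"
    using exp_converges[of e] by (metis sums_iff sums_mult2)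
  finally show ?thesis .
qed

text \<open>What matters of \<open>H\<close> and \<open>\<psi>\<close> later on is the energy
  distribution \<open>sqn d (B x)\<close> on \<open>\<Lambda>\<close>. It has at least two points
  because \<open>\<psi>\<close> is not an eigenvector; this is what makes clock states at different
  times distinguishable.\<close>

lemma clock_spectral:
  assumes H: "H \<in> carrier_mat d d" and adj: "mat_adjoint H = H"
    and \<psi>: "\<psi> \<in> carrier_vec d" and unit: "\<psi> \<bullet>c \<psi> = 1" and not_eig: "\<not> (\<exists>E. eigenvector H \<psi> E)"
  obtains \<Lambda> :: "real set" and B :: "real \<Rightarrow> nat \<Rightarrow> complex" where
    "finite \<Lambda>" and "\<exists>x\<in>\<Lambda>. \<exists>y\<in>\<Lambda>. x \<noteq> y" and "\<And>x. x \<in> \<Lambda> \<Longrightarrow> 0 < sqn d (B x)"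
    and "\<And>x y. x \<in> \<Lambda> \<Longrightarrow> y \<in> \<Lambda> \<Longrightarrow> x \<noteq> y \<Longrightarrow> ip d (B x) (B y) = 0"
    and "(\<Sum>x\<in>\<Lambda>. sqn d (B x)) = 1"
    and "\<And>t i. i < d \<Longrightarrow> clock_state H \<psi> t $ i = (\<Sum>x\<in>\<Lambda>. exp (- \<i> * t * x) * B x i)"
proof -
  let ?h = "\<lambda>i j. H $$ (i, j)"
  have herm: "H $$ (j, i) = cnj (H $$ (i, j))" if "i < d" "j < d" for i j
  proof -
    have "mat_adjoint H $$ (j, i) = cnj (H $$ (i, j))"
      using H that by (simp add: mat_adjoint_def mat_of_rows_def)
    then show ?thesis by (simp add: adj)
  qed
  from eigen_sum_hermitian[OF H herm, of "($) \<psi>"] obtain S A where S: "finite S"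
    and A: "\<And>e i. e \<in> S \<Longrightarrow> i < d \<Longrightarrow> app d ?h (A e) i = e * A e i"
    and sum: "\<And>i. i < d \<Longrightarrow> \<psi> $ i = (\<Sum>e\<in>S. A e i)" unfolding eigen_sum_def by blast
  \<comment> \<open>Zero components are dropped, since only a nonzero eigenvector forces its
    eigenvalue to be real.\<close>
  define S' where "S' = {e\<in>S. sqn d (A e) \<noteq> 0}"
  have S': "finite S'" using S by (simp add: S'_def)
  have real: "complex_of_real (Re e) = e" if "e \<in> S'" for e
  proof -
    have "cnj e = e" using A that by (intro hermitian_eigenvalue_real[of d ?h, OF herm]) (auto simp: S'_def)
    then show ?thesis by (simp add: complex_eq_iff)
  qed
  define \<Lambda> where "\<Lambda> = Re ` S'"
  define B where "B x = A (complex_of_real x)" for x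
  have mem: "complex_of_real x \<in> S'" if "x \<in> \<Lambda>" for x using that real by (auto simp: \<Lambda>_def)
  have bij: "inj_on Re S'" by (rule inj_on_inverseI[of _ complex_of_real]) (rule real)
  have eig: "app d ?h (B x) i = complex_of_real x * B x i" if "x \<in> \<Lambda>" "i < d" for x i
    using mem[OF that(1)] A that(2) by (simp add: S'_def B_def)
  have pos: "0 < sqn d (B x)" if "x \<in> \<Lambda>" for x
    using mem[OF that] sqn_nonneg[of d "B x"] unfolding S'_def B_def less_le by auto
  have \<psi>_sum: "\<psi> $ i = (\<Sum>x\<in>\<Lambda>. B x i)" if "i < d" for i
  proof -
    have "\<psi> $ i = (\<Sum>e\<in>S'. A e i)"
      unfolding sum[OF that] using S that
      by (intro sum.mono_neutral_right) (auto simp: S'_def dest: sqn_eq_0)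
    also have "\<dots> = (\<Sum>x\<in>\<Lambda>. B x i)" unfolding \<Lambda>_def B_def by (simp add: sum.reindex[OF bij] real)
    finally show ?thesis .
  qed
  have orth: "ip d (B x) (B y) = 0" if "x \<in> \<Lambda>" "y \<in> \<Lambda>" "x \<noteq> y" for x y
    using eig that by (intro hermitian_eigen_orthogonal[of d ?h "B x" x "B y" y, OF herm]) auto
  have fin: "finite \<Lambda>" using S' by (simp add: \<Lambda>_def)
  have "complex_of_real (\<Sum>x\<in>\<Lambda>. sqn d (B x)) = 1"
  proof -
    have "1 = ip d (($) \<psi>) (($) \<psi>)" using unit \<psi> by (simp add: cinner_conv_ip[of _ d])
    also have "\<dots> = ip d (\<lambda>i. \<Sum>x\<in>\<Lambda>. B x i) (\<lambda>i. \<Sum>x\<in>\<Lambda>. B x i)" by (rule ip_cong) (simp_all add: \<psi>_sum)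
    also have "\<dots> = (\<Sum>i<d. \<Sum>x\<in>\<Lambda>. \<Sum>y\<in>\<Lambda>. B x i * cnj (B y i))" by (simp add: ip_def sum_product)
    also have "\<dots> = (\<Sum>x\<in>\<Lambda>. \<Sum>i<d. \<Sum>y\<in>\<Lambda>. B x i * cnj (B y i))" by (rule sum.swap)
    also have "\<dots> = (\<Sum>x\<in>\<Lambda>. \<Sum>y\<in>\<Lambda>. ip d (B x) (B y))"
      unfolding ip_def by (intro sum.cong refl sum.swap)
    also have "\<dots> = (\<Sum>x\<in>\<Lambda>. \<Sum>y\<in>\<Lambda>. if x = y then complex_of_real (sqn d (B x)) else 0)"
      by (intro sum.cong refl) (auto simp: orth ip_self)
    also have "\<dots> = complex_of_real (\<Sum>x\<in>\<Lambda>. sqn d (B x))" using fin by simp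
    finally show ?thesis by simp
  qed
  then have one: "(\<Sum>x\<in>\<Lambda>. sqn d (B x)) = 1" by (simp only: of_real_eq_1_iff)
  have two: "\<exists>x\<in>\<Lambda>. \<exists>y\<in>\<Lambda>. x \<noteq> y"
  proof (rule ccontr)
    assume c: "\<not> ?thesis"
    have "\<Lambda> \<noteq> {}" using one by auto
    with c obtain x where x: "\<Lambda> = {x}" by blast
    have "H *\<^sub>v \<psi> = complex_of_real x \<cdot>\<^sub>v \<psi>"
    proof (rule eq_vecI)
      fix i assume "i < dim_vec (complex_of_real x \<cdot>\<^sub>v \<psi>)"
      then have i: "i < d" using \<psi> by simp
      have "(H *\<^sub>v \<psi>) $ i = app d ?h (($) \<psi>) i" by (simp only: mult_mat_vec_index[OF H \<psi> i] app_def)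
      also have "\<dots> = app d ?h (B x) i" using \<psi>_sum by (subst app_cong[of d "($) \<psi>" "B x"]) (simp_all add: x)
      also have "\<dots> = (complex_of_real x \<cdot>\<^sub>v \<psi>) $ i" using eig[of x i] \<psi>_sum[of i] x i \<psi> by simp
      finally show "(H *\<^sub>v \<psi>) $ i = (complex_of_real x \<cdot>\<^sub>v \<psi>) $ i" .
    qed (use H \<psi> in simp)
    moreover have "\<psi> \<noteq> 0\<^sub>v d" using unit by auto
    ultimately have "eigenvector H \<psi> (complex_of_real x)" using H \<psi> by (simp add: eigenvector_def)
    then show False using not_eig by blast
  qed
  have clock: "clock_state H \<psi> t $ i = (\<Sum>x\<in>\<Lambda>. exp (- \<i> * t * x) * B x i)" if i: "i < d" for t i
  proof -
    let ?B = "(- \<i> * complex_of_real t) \<cdot>\<^sub>m H"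
    have Bc: "?B \<in> carrier_mat d d" using H by simp
    have "app d (\<lambda>i j. ?B $$ (i, j)) u i = (- \<i> * complex_of_real t) * app d ?h u i" if "i < d" for u i
      using H that by (simp add: app_def sum_distrib_left mult_ac)
    then have eB: "app d (\<lambda>i j. ?B $$ (i, j)) (B x) i = (- \<i> * t * x) * B x i" if "x \<in> \<Lambda>" "i < d" for x i
      using eig that by simp
    have "mat_exp ?B \<in> carrier_mat d d" using H by (simp add: mat_exp_def)
    then have "clock_state H \<psi> t $ i = (\<Sum>j<d. mat_exp ?B $$ (i, j) * (\<Sum>x\<in>\<Lambda>. B x j))"
      unfolding clock_state_def by (subst mult_mat_vec_index[OF _ \<psi> i]) (simp_all add: \<psi>_sum)
    also have "\<dots> = (\<Sum>x\<in>\<Lambda>. \<Sum>j<d. mat_exp ?B $$ (i, j) * B x j)"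
      unfolding sum_distrib_left by (rule sum.swap)
    also have "\<dots> = (\<Sum>x\<in>\<Lambda>. exp (- \<i> * t * x) * B x i)"
      by (intro sum.cong refl mat_exp_eigen[OF Bc] eB i)
    finally show ?thesis .
  qed
  show ?thesis by (rule that[OF fin two pos orth one clock])
qed

subsection \<open>Energy distribution of tensor powers\<close>

lemma sum_pair_index:
  fixes f :: "nat \<Rightarrow> 'a::comm_monoid_add"
  shows "(\<Sum>i<n * m. f i) = (\<Sum>a<n. \<Sum>b<m. f (a * m + b))"
proof -
  have "(\<Sum>i<n * m. f i) = (\<Sum>a<n. sum f {a * m..<a * m + m})" by (rule sum.nat_group[symmetric])
  also have "\<dots> = (\<Sum>a<n. \<Sum>b<m. f (a * m + b))"
  proof (rule sum.cong[OF refl])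
    fix a
    show "sum f {a * m..<a * m + m} = (\<Sum>b<m. f (a * m + b))"
      by (rule sum.reindex_bij_witness[of _ "\<lambda>b. a * m + b" "\<lambda>i. i - a * m"]) auto
  qed
  finally show ?thesis .
qed

lemma dim_tensor_pow_vec: "dim_vec (tensor_pow_vec v N) = dim_vec v ^ N"
  by (induction N) (simp_all add: tensor_vec_def)

lemma tensor_pow_vec_carrier: "v \<in> carrier_vec d \<Longrightarrow> tensor_pow_vec v N \<in> carrier_vec (d ^ N)"
  by (auto intro!: carrier_vecI simp: dim_tensor_pow_vec)

lemma tensor_pow_vec_Suc_index:
  assumes "v \<in> carrier_vec d" "i < d ^ Suc N"
  shows "tensor_pow_vec v (Suc N) $ i = v $ (i div d ^ N) * tensor_pow_vec v N $ (i mod d ^ N)"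
proof -
  have "dim_vec v = d" "dim_vec (tensor_pow_vec v N) = d ^ N"
    using assms(1) by (auto simp: dim_tensor_pow_vec)
  then show ?thesis using assms(2) by (simp add: tensor_vec_def)
qed

lemma tensor_pow_mat_ket_bra:
  assumes v: "v \<in> carrier_vec d"
  shows "tensor_pow_mat (ket_bra v) N = ket_bra (tensor_pow_vec v N)"
proof (induction N)
  case 0
  show ?case by (rule eq_matI) (auto simp: ket_bra_def)
next
  case (Suc N)
  have n: "dim_vec (tensor_pow_vec v N) = d ^ N" using tensor_pow_vec_carrier[OF v] by auto
  show ?case
  proof (rule eq_matI)
    fix i j assume "i < dim_row (ket_bra (tensor_pow_vec v (Suc N)))" "j < dim_col (ket_bra (tensor_pow_vec v (Suc N)))"
    then have ij: "i < d * d ^ N" "j < d * d ^ N" using v n by (auto simp: ket_bra_def tensor_vec_def)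
    then have pos: "0 < d ^ N" by (cases "d ^ N = 0") auto
    have "i div d ^ N < d" "j div d ^ N < d" using ij by (auto simp: less_mult_imp_div_less)
    then show "tensor_pow_mat (ket_bra v) (Suc N) $$ (i, j) = ket_bra (tensor_pow_vec v (Suc N)) $$ (i, j)"
      using v n ij pos by (simp add: Suc) (simp add: tensor_mat_def ket_bra_def tensor_vec_def)
  qed (use v n in \<open>simp_all add: Suc, simp_all add: tensor_mat_def ket_bra_def tensor_vec_def\<close>)
qed

lemma ip_tensor_pow_vec:
  assumes v: "v \<in> carrier_vec d" and w: "w \<in> carrier_vec d"
  shows "ip (d ^ N) (($) (tensor_pow_vec v N)) (($) (tensor_pow_vec w N)) = ip d (($) v) (($) w) ^ N"
proof (induction N)
  case 0
  show ?case by (simp add: ip_def)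
next
  case (Suc N)
  have "ip (d ^ Suc N) (($) (tensor_pow_vec v (Suc N))) (($) (tensor_pow_vec w (Suc N)))
      = (\<Sum>a<d. \<Sum>b<d ^ N. (v $ a * cnj (w $ a)) * (tensor_pow_vec v N $ b * cnj (tensor_pow_vec w N $ b)))"
    unfolding ip_def power_Suc sum_pair_index
  proof (intro sum.cong refl)
    fix a b assume "a \<in> {..<d}" "b \<in> {..<d ^ N}"
    then have ab: "a < d" "b < d ^ N" by auto
    then have "a * d ^ N + b < d ^ Suc N" using pair_index_less[of a d b "d ^ N"] by simp
    with ab show "tensor_pow_vec v (Suc N) $ (a * d ^ N + b) * cnj (tensor_pow_vec w (Suc N) $ (a * d ^ N + b))
        = (v $ a * cnj (w $ a)) * (tensor_pow_vec v N $ b * cnj (tensor_pow_vec w N $ b))"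
      by (subst (1 2) tensor_pow_vec_Suc_index[OF _ \<open>a * d ^ N + b < d ^ Suc N\<close>])
        (use v w in \<open>auto simp del: tensor_pow_vec.simps\<close>)
  qed
  also have "\<dots> = ip d (($) v) (($) w) * ip (d ^ N) (($) (tensor_pow_vec v N)) (($) (tensor_pow_vec w N))"
    by (simp add: ip_def sum_product)
  finally show ?case by (simp add: Suc)
qed

lemma sqn_tensor_pow_vec:
  assumes v: "v \<in> carrier_vec d"
  shows "sqn (d ^ N) (($) (tensor_pow_vec v N)) = sqn d (($) v) ^ N"
proof -
  have "complex_of_real (sqn (d ^ N) (($) (tensor_pow_vec v N))) = complex_of_real (sqn d (($) v) ^ N)"
    using ip_tensor_pow_vec[OF v v, of N] by (simp add: ip_self)
  then show ?thesis by (simp only: of_real_eq_iff)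
qed

text \<open>Energies of the copies add, so pairs are grouped by their sum. The components
  \<open>A\<close> do not depend on \<open>z\<close>: the same ones describe the evolution at real
  times and the reweighted states at complex times.\<close>

lemma tensor_pow_exp_sum:
  fixes B :: "real \<Rightarrow> nat \<Rightarrow> complex" and v :: "complex \<Rightarrow> complex vec"
  assumes fin: "finite \<Lambda>" and c: "\<And>z. v z \<in> carrier_vec d"
    and v: "\<And>z i. i < d \<Longrightarrow> v z $ i = (\<Sum>x\<in>\<Lambda>. exp (z * complex_of_real x) * B x i)"
  shows "\<exists>S A. finite S \<and> (\<forall>z. \<forall>i<d ^ N. tensor_pow_vec (v z) N $ i
    = (\<Sum>E\<in>S. exp (z * complex_of_real E) * A E i))"
proof (induction N)
  case 0
  show ?case by (intro exI[of _ "{0}"] exI[of _ "\<lambda>_ _. 1"]) simp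
next
  case (Suc N)
  then obtain S A where S: "finite S" and A: "\<And>z i. i < d ^ N \<Longrightarrow> tensor_pow_vec (v z) N $ i
    = (\<Sum>E\<in>S. exp (z * complex_of_real E) * A E i)" by blast
  let ?g = "\<lambda>(x, y). x + y :: real"
  define C where "C E i = (\<Sum>p\<in>{p. p \<in> \<Lambda> \<times> S \<and> ?g p = E}. B (fst p) (i div d ^ N) * A (snd p) (i mod d ^ N))" for E i
  have "tensor_pow_vec (v z) (Suc N) $ i = (\<Sum>E\<in>?g ` (\<Lambda> \<times> S). exp (z * complex_of_real E) * C E i)"
    if i: "i < d ^ Suc N" for z i
  proof -
    have "i < d * d ^ N" using i by simp
    then have "0 < d ^ N" by (cases "d ^ N = 0") auto
    then have k: "i div d ^ N < d" "i mod d ^ N < d ^ N"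
      using \<open>i < d * d ^ N\<close> by (auto simp: less_mult_imp_div_less)
    have "tensor_pow_vec (v z) (Suc N) $ i
        = (\<Sum>p\<in>\<Lambda> \<times> S. exp (z * complex_of_real (?g p)) * (B (fst p) (i div d ^ N) * A (snd p) (i mod d ^ N)))"
      unfolding tensor_pow_vec_Suc_index[OF c i] v[OF k(1)] A[OF k(2)] sum_product sum.cartesian_product
      by (intro sum.cong refl) (simp add: case_prod_unfold distrib_left exp_add mult_ac)
    also have "\<dots> = (\<Sum>E\<in>?g ` (\<Lambda> \<times> S). \<Sum>p\<in>{p. p \<in> \<Lambda> \<times> S \<and> ?g p = E}.
        exp (z * complex_of_real (?g p)) * (B (fst p) (i div d ^ N) * A (snd p) (i mod d ^ N)))"
      using fin S by (intro sum.image_gen) simp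
    also have "\<dots> = (\<Sum>E\<in>?g ` (\<Lambda> \<times> S). exp (z * complex_of_real E) * C E i)"
      unfolding C_def sum_distrib_left by (intro sum.cong refl) auto
    finally show ?thesis .
  qed
  then show ?case using fin S by (intro exI[of _ "?g ` (\<Lambda> \<times> S)"] exI[of _ C]) auto
qed

lemma cnj_exp: "cnj (exp z) = exp (cnj z)"
  by (simp add: complex_eq_iff Re_exp Im_exp)

lemma ip_exp_sum:
  assumes fin: "finite \<Lambda>" and orth: "\<And>x y. x \<in> \<Lambda> \<Longrightarrow> y \<in> \<Lambda> \<Longrightarrow> x \<noteq> y \<Longrightarrow> ip d (B x) (B y) = 0"
  shows "ip d (\<lambda>i. \<Sum>x\<in>\<Lambda>. exp (z * complex_of_real x) * B x i) (\<lambda>i. \<Sum>x\<in>\<Lambda>. exp (w * complex_of_real x) * B x i)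
    = (\<Sum>x\<in>\<Lambda>. exp ((z + cnj w) * complex_of_real x) * sqn d (B x))"
proof -
  let ?e = "\<lambda>z x. exp (z * complex_of_real x)"
  have "ip d (\<lambda>i. \<Sum>x\<in>\<Lambda>. ?e z x * B x i) (\<lambda>i. \<Sum>x\<in>\<Lambda>. ?e w x * B x i)
      = (\<Sum>i<d. \<Sum>x\<in>\<Lambda>. \<Sum>y\<in>\<Lambda>. (?e z x * ?e (cnj w) y) * (B x i * cnj (B y i)))"
    by (simp add: ip_def sum_product cnj_exp mult_ac)
  also have "\<dots> = (\<Sum>x\<in>\<Lambda>. \<Sum>i<d. \<Sum>y\<in>\<Lambda>. (?e z x * ?e (cnj w) y) * (B x i * cnj (B y i)))" by (rule sum.swap)
  also have "\<dots> = (\<Sum>x\<in>\<Lambda>. \<Sum>y\<in>\<Lambda>. \<Sum>i<d. (?e z x * ?e (cnj w) y) * (B x i * cnj (B y i)))"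
    by (intro sum.cong refl sum.swap)
  also have "\<dots> = (\<Sum>x\<in>\<Lambda>. \<Sum>y\<in>\<Lambda>. (?e z x * ?e (cnj w) y) * ip d (B x) (B y))"
    by (simp add: ip_def sum_distrib_left)
  also have "\<dots> = (\<Sum>x\<in>\<Lambda>. \<Sum>y\<in>\<Lambda>. if x = y then ?e (z + cnj w) x * sqn d (B x) else 0)"
    by (intro sum.cong refl) (auto simp: orth ip_self distrib_right exp_add)
  also have "\<dots> = (\<Sum>x\<in>\<Lambda>. ?e (z + cnj w) x * sqn d (B x))" using fin by simp
  finally show ?thesis .
qed

text \<open>
  At the complex times \<open>t + i \<theta> / 2\<close> the components are reweighted by \<open>exp (\<theta> E / 2)\<close>, so averaging
  over \<open>t\<close> yields the moment generating function of the energy distribution.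
\<close>

lemma energy_mgf:
  fixes A :: "real \<Rightarrow> nat \<Rightarrow> complex"
  assumes S: "finite S" and f: "\<And>z i. i < n \<Longrightarrow> f z i = (\<Sum>E\<in>S. exp (z * complex_of_real E) * A E i)"
    and g: "\<And>z. sqn n (f z) = g (2 * Re z)"
  shows "(\<Sum>E\<in>S. exp (\<theta> * E) * sqn n (A E)) = g \<theta>"
proof -
  let ?D = "(\<lambda>(E, F). E - F) ` ((S \<times> S) - Id)"
  have "finite ?D" "0 \<notin> ?D" using S by auto
  from annihilating_times[OF this] obtain N :: nat and T where
    N: "0 < N" and T0: "\<forall>s\<in>?D. (\<Sum>k<N. cis (T k * s)) = 0" by blast
  have T: "(\<Sum>j<N. cis (T j * (E - F))) = 0" if "E \<in> S" "F \<in> S" "E \<noteq> F" for E F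
    using T0 that by force
  have e: "exp ((\<theta> / 2 - \<i> * T j) * complex_of_real E) = cis (- (T j * E)) * exp (\<theta> * E / 2)" for j E
  proof -
    have "(\<theta> / 2 - \<i> * T j) * complex_of_real E = \<i> * complex_of_real (- (T j * E)) + complex_of_real (\<theta> * E / 2)"
      by (simp add: algebra_simps)
    then show ?thesis by (simp only: exp_add cis_conv_exp exp_of_real)
  qed
  have "real N * g \<theta> = (\<Sum>j<N. sqn n (f (\<theta> / 2 - \<i> * T j)))" by (simp add: g)
  also have "\<dots> = (\<Sum>j<N. \<Sum>i<n. (cmod (\<Sum>E\<in>S. cis (- (T j * E)) * (exp (\<theta> * E / 2) * A E i)))\<^sup>2)"
    unfolding sqn_def by (intro sum.cong refl) (simp only: f e mult.assoc lessThan_iff)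
  also have "\<dots> = (\<Sum>i<n. \<Sum>j<N. (cmod (\<Sum>E\<in>S. cis (- (T j * E)) * (exp (\<theta> * E / 2) * A E i)))\<^sup>2)"
    by (rule sum.swap)
  also have "\<dots> = (\<Sum>i<n. real N * (\<Sum>E\<in>S. (cmod (exp (\<theta> * E / 2) * A E i))\<^sup>2))"
    by (intro sum.cong refl Parseval_times S T)
  also have "\<dots> = real N * (\<Sum>i<n. \<Sum>E\<in>S. exp (\<theta> * E) * (cmod (A E i))\<^sup>2)"
    by (simp add: sum_distrib_left norm_mult power_mult_distrib exp_double[symmetric])
  also have "(\<Sum>i<n. \<Sum>E\<in>S. exp (\<theta> * E) * (cmod (A E i))\<^sup>2) = (\<Sum>E\<in>S. exp (\<theta> * E) * sqn n (A E))"
    unfolding sqn_def sum_distrib_left by (rule sum.swap)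
  finally show ?thesis using N by simp
qed

section \<open>Exponential moments and tails of the energy distribution\<close>

text \<open>Negative arguments are treated through the reciprocal:
  \<open>(1 - y + y\<^sup>2) * (1 + y + y\<^sup>2 / 2)\<close> is at least 1 for
  \<open>y \<ge> 0\<close>, and the second factor is at most \<open>exp y\<close>.\<close>

lemma exp_le_quadratic:
  fixes x :: real
  assumes "\<bar>x\<bar> \<le> 1"
  shows "exp x \<le> 1 + x + x\<^sup>2"
proof (cases "0 \<le> x")
  case True
  then show ?thesis using assms exp_bound[of x] by simp
next
  case False
  define y where "y = - x"
  have y: "0 \<le> y" "y \<le> 1" using False assms by (auto simp: y_def)
  have "1 \<le> 1 + (y\<^sup>2 + y ^ 3 + y ^ 4) / 2" using y by simp
  also have "\<dots> = (1 - y + y\<^sup>2) * (1 + y + y\<^sup>2 / 2)"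
    by (simp add: field_simps power2_eq_square power3_eq_cube power4_eq_xxxx)
  also have "\<dots> \<le> (1 - y + y\<^sup>2) * exp y"
    using y exp_lower_Taylor_quadratic[of y] by (intro mult_left_mono) auto
  finally have "exp (- y) \<le> 1 - y + y\<^sup>2" by (simp add: exp_minus field_simps)
  then show ?thesis by (simp add: y_def)
qed

text \<open>The linear term of the quadratic bound averages to zero because \<open>\<mu>\<close> is
  the mean. This is Hoeffding's lemma with a cruder constant and for small
  \<open>\<theta>\<close>.\<close>

lemma centred_mgf_bound:
  fixes p :: "real \<Rightarrow> real"
  assumes p: "\<And>x. x \<in> \<Lambda> \<Longrightarrow> 0 \<le> p x" "(\<Sum>x\<in>\<Lambda>. p x) = 1"
    and \<mu>: "\<mu> = (\<Sum>x\<in>\<Lambda>. p x * x)" and b: "\<And>x. x \<in> \<Lambda> \<Longrightarrow> \<bar>x - \<mu>\<bar> \<le> b" and \<theta>: "\<bar>\<theta>\<bar> * b \<le> 1"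
  shows "exp (- \<theta> * \<mu>) * (\<Sum>x\<in>\<Lambda>. exp (\<theta> * x) * p x) \<le> exp (\<theta>\<^sup>2 * b\<^sup>2)"
proof -
  have "exp (- \<theta> * \<mu>) * (\<Sum>x\<in>\<Lambda>. exp (\<theta> * x) * p x) = (\<Sum>x\<in>\<Lambda>. exp (\<theta> * (x - \<mu>)) * p x)"
    by (simp add: sum_distrib_left mult.assoc[symmetric] right_diff_distrib flip: exp_add)
  also have "\<dots> \<le> (\<Sum>x\<in>\<Lambda>. (1 + \<theta> * (x - \<mu>) + \<theta>\<^sup>2 * b\<^sup>2) * p x)"
  proof (intro sum_mono mult_right_mono)
    fix x assume x: "x \<in> \<Lambda>"
    have le: "\<bar>\<theta> * (x - \<mu>)\<bar> \<le> \<bar>\<theta>\<bar> * b" using b[OF x] by (simp add: abs_mult mult_left_mono)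
    then have "exp (\<theta> * (x - \<mu>)) \<le> 1 + \<theta> * (x - \<mu>) + (\<theta> * (x - \<mu>))\<^sup>2"
      using \<theta> by (intro exp_le_quadratic) linarith
    also have "(\<theta> * (x - \<mu>))\<^sup>2 \<le> (\<bar>\<theta>\<bar> * b)\<^sup>2"
      using power_mono[OF le abs_ge_zero, of 2] by simp
    finally show "exp (\<theta> * (x - \<mu>)) \<le> 1 + \<theta> * (x - \<mu>) + \<theta>\<^sup>2 * b\<^sup>2" by (simp add: power_mult_distrib)
  qed (use p in auto)
  also have "\<dots> = (1 - \<theta> * \<mu> + \<theta>\<^sup>2 * b\<^sup>2) * (\<Sum>x\<in>\<Lambda>. p x) + \<theta> * (\<Sum>x\<in>\<Lambda>. p x * x)"
    unfolding sum_distrib_left sum.distrib[symmetric] by (intro sum.cong refl) (simp add: algebra_simps)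
  also have "\<dots> = 1 + \<theta>\<^sup>2 * b\<^sup>2" using p \<mu> by simp
  also have "\<dots> \<le> exp (\<theta>\<^sup>2 * b\<^sup>2)" by (rule exp_ge_add_one_self)
  finally show ?thesis .
qed

text \<open>On the tail one of \<open>exp (\<theta> * (E - E0))\<close> and
  \<open>exp (- \<theta> * (E - E0))\<close> is at least \<open>exp (\<theta> * L)\<close>. Adding
  both treats the two sides together and accounts for the factor 2.\<close>

lemma Chernoff_tail:
  fixes w :: "real \<Rightarrow> real"
  assumes S: "finite S" and w: "\<And>E. E \<in> S \<Longrightarrow> 0 \<le> w E" and \<theta>: "0 \<le> \<theta>"
    and mgf: "\<And>\<tau>. \<bar>\<tau>\<bar> = \<theta> \<Longrightarrow> exp (- \<tau> * E0) * (\<Sum>E\<in>S. exp (\<tau> * E) * w E) \<le> b"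
  shows "(\<Sum>E\<in>{E\<in>S. \<bar>E - E0\<bar> > L}. w E) \<le> 2 * exp (- \<theta> * L) * b"
proof -
  have "(\<Sum>E\<in>{E\<in>S. \<bar>E - E0\<bar> > L}. w E)
      \<le> (\<Sum>E\<in>{E\<in>S. \<bar>E - E0\<bar> > L}. exp (- \<theta> * L) * (exp (\<theta> * (E - E0)) * w E + exp (- \<theta> * (E - E0)) * w E))"
  proof (intro sum_mono)
    fix E assume E: "E \<in> {E\<in>S. \<bar>E - E0\<bar> > L}"
    have "1 \<le> exp (\<theta> * (\<bar>E - E0\<bar> - L))" using E \<theta> by simp
    also have "\<dots> = exp (- \<theta> * L) * exp (\<theta> * \<bar>E - E0\<bar>)" by (simp add: algebra_simps flip: exp_add)
    also have "\<dots> \<le> exp (- \<theta> * L) * (exp (\<theta> * (E - E0)) + exp (- \<theta> * (E - E0)))"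
      by (intro mult_left_mono, cases "E0 \<le> E") (simp_all add: algebra_simps)
    finally have "1 * w E \<le> (exp (- \<theta> * L) * (exp (\<theta> * (E - E0)) + exp (- \<theta> * (E - E0)))) * w E"
      using w E by (intro mult_right_mono) auto
    then show "w E \<le> exp (- \<theta> * L) * (exp (\<theta> * (E - E0)) * w E + exp (- \<theta> * (E - E0)) * w E)"
      by (simp add: algebra_simps)
  qed
  also have "\<dots> \<le> (\<Sum>E\<in>S. exp (- \<theta> * L) * (exp (\<theta> * (E - E0)) * w E + exp (- \<theta> * (E - E0)) * w E))"
    using S w by (intro sum_mono2) (auto intro!: mult_nonneg_nonneg add_nonneg_nonneg)
  also have "\<dots> = exp (- \<theta> * L) * (exp (- \<theta> * E0) * (\<Sum>E\<in>S. exp (\<theta> * E) * w E)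
      + exp (- (- \<theta>) * E0) * (\<Sum>E\<in>S. exp (- \<theta> * E) * w E))"
    by (simp add: sum_distrib_left sum.distrib algebra_simps mult.assoc[symmetric] flip: exp_add)
  also have "\<dots> \<le> exp (- \<theta> * L) * (b + b)"
    using \<theta> by (intro mult_left_mono add_mono mgf) auto
  finally show ?thesis by simp
qed

section \<open>Decay of the overlap of clock states at nearby times\<close>

text \<open>With \<open>1 - cos x = 2 * (sin (x / 2))\<^sup>2\<close> it suffices that
  \<open>\<bar>sin y\<bar> \<ge> \<bar>y\<bar> / 2\<close> for small \<open>y\<close>, which the
  cubic Taylor remainder gives.\<close>

lemma one_minus_cos_ge:
  fixes x :: real
  assumes "\<bar>x\<bar> \<le> 1"
  shows "x\<^sup>2 / 8 \<le> 1 - cos x"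
proof -
  let ?y = "x / 2"
  have "\<bar>sin ?y - ?y\<bar> \<le> \<bar>?y\<bar> ^ 3 / 6"
    using Maclaurin_sin_bound[of ?y 3] by (simp add: numeral_3_eq_3 sin_coeff_def fact_numeral)
  also have "\<dots> \<le> \<bar>?y\<bar> / 2"
  proof -
    have "\<bar>?y\<bar> ^ 3 = \<bar>?y\<bar> * \<bar>?y\<bar>\<^sup>2" by (simp add: power3_eq_cube power2_eq_square)
    also have "\<dots> \<le> \<bar>?y\<bar> * 1" using assms by (intro mult_left_mono power_le_one) auto
    finally show ?thesis by simp
  qed
  finally have "\<bar>?y\<bar> / 2 \<le> \<bar>sin ?y\<bar>" by linarith
  then have "(\<bar>?y\<bar> / 2)\<^sup>2 \<le> \<bar>sin ?y\<bar>\<^sup>2" by (intro power_mono) auto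
  then have "x\<^sup>2 / 16 \<le> (sin ?y)\<^sup>2" by (simp add: power_divide)
  moreover have "cos x = 1 - 2 * (sin ?y)\<^sup>2" using cos_double_sin[of ?y] by simp
  ultimately show ?thesis by simp
qed

text \<open>The squared modulus of the characteristic function is 1 minus the mean of
  \<open>1 - cos (s * (u - v))\<close> over independent \<open>u\<close> and \<open>v\<close>. All
  terms of this mean are nonnegative, and the single pair \<open>(x, y)\<close> already contributes
  quadratically in \<open>s\<close>.\<close>

lemma char_fun_decay:
  fixes p :: "real \<Rightarrow> real"
  assumes fin: "finite \<Lambda>" and p: "\<And>x. x \<in> \<Lambda> \<Longrightarrow> 0 < p x" "(\<Sum>x\<in>\<Lambda>. p x) = 1"
    and two: "\<exists>x\<in>\<Lambda>. \<exists>y\<in>\<Lambda>. x \<noteq> y"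
  obtains q r :: real where "0 < q" "0 < r"
    "\<And>s. \<bar>s\<bar> \<le> r \<Longrightarrow> cmod (\<Sum>x\<in>\<Lambda>. cis (s * x) * p x) \<le> exp (- q * s\<^sup>2)"
proof -
  obtain x y where xy: "x \<in> \<Lambda>" "y \<in> \<Lambda>" "x \<noteq> y" using two by blast
  \<comment> \<open>A factor \<open>1 / 8\<close> comes from \<open>one_minus_cos_ge\<close> and a
    further \<open>1 / 2\<close> from the square root of the squared modulus. The radius
    \<open>r\<close> ensures \<open>\<bar>s * (x - y)\<bar> \<le> 1\<close>.\<close>
  define q where "q = p x * p y * (x - y)\<^sup>2 / 16"
  define r where "r = 1 / \<bar>x - y\<bar>"
  have q: "0 < q" and r: "0 < r" using xy p by (auto simp: q_def r_def)
  have "cmod (\<Sum>x\<in>\<Lambda>. cis (s * x) * p x) \<le> exp (- q * s\<^sup>2)" if s: "\<bar>s\<bar> \<le> r" for s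
  proof -
    have "(cmod (\<Sum>x\<in>\<Lambda>. cis (s * x) * p x))\<^sup>2
        = (\<Sum>u\<in>\<Lambda>. cos (s * u) * p u)\<^sup>2 + (\<Sum>u\<in>\<Lambda>. sin (s * u) * p u)\<^sup>2"
      by (simp add: cmod_power2)
    moreover have "\<dots> = (\<Sum>u\<in>\<Lambda>. \<Sum>v\<in>\<Lambda>. p u * p v - (1 - cos (s * (u - v))) * (p u * p v))"
      unfolding power2_eq_square sum_product sum.distrib[symmetric]
      by (intro sum.cong refl)
        (simp add: cos_diff right_diff_distrib left_diff_distrib distrib_right distrib_left mult_ac)
    moreover have "\<dots> = (\<Sum>u\<in>\<Lambda>. \<Sum>v\<in>\<Lambda>. p u * p v)
        - (\<Sum>u\<in>\<Lambda>. \<Sum>v\<in>\<Lambda>. (1 - cos (s * (u - v))) * (p u * p v))"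
      by (simp only: sum_subtractf)
    moreover have "(\<Sum>u\<in>\<Lambda>. \<Sum>v\<in>\<Lambda>. p u * p v) = 1"
      using p(2) by (simp add: sum_product[symmetric])
    ultimately have eq: "(cmod (\<Sum>x\<in>\<Lambda>. cis (s * x) * p x))\<^sup>2
      = 1 - (\<Sum>u\<in>\<Lambda>. \<Sum>v\<in>\<Lambda>. (1 - cos (s * (u - v))) * (p u * p v))"
      by linarith
    have nn: "0 \<le> (1 - cos (s * (u - v))) * (p u * p v)" if "u \<in> \<Lambda>" "v \<in> \<Lambda>" for u v
      using that p(1)[of u] p(1)[of v] by (intro mult_nonneg_nonneg) auto
    have "\<bar>s * (x - y)\<bar> \<le> r * \<bar>x - y\<bar>" using s by (simp add: abs_mult mult_right_mono)
    then have "\<bar>s * (x - y)\<bar> \<le> 1" using xy by (simp add: r_def)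
    then have "(s * (x - y))\<^sup>2 / 8 \<le> 1 - cos (s * (x - y))" by (rule one_minus_cos_ge)
    then have "(s * (x - y))\<^sup>2 / 8 * (p x * p y) \<le> (1 - cos (s * (x - y))) * (p x * p y)"
      using p(1)[OF xy(1)] p(1)[OF xy(2)] by (intro mult_right_mono) auto
    also have "\<dots> \<le> (\<Sum>v\<in>\<Lambda>. (1 - cos (s * (x - v))) * (p x * p v))"
      by (rule member_le_sum[OF xy(2) _ fin]) (rule nn[OF xy(1)], simp)
    also have "\<dots> \<le> (\<Sum>u\<in>\<Lambda>. \<Sum>v\<in>\<Lambda>. (1 - cos (s * (u - v))) * (p u * p v))"
      by (rule member_le_sum[OF xy(1) _ fin]) (rule sum_nonneg, rule nn, auto)
    finally have "(s * (x - y))\<^sup>2 / 8 * (p x * p y)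
      \<le> 1 - (cmod (\<Sum>x\<in>\<Lambda>. cis (s * x) * p x))\<^sup>2" using eq by linarith
    moreover have "(s * (x - y))\<^sup>2 / 8 * (p x * p y) = 2 * (q * s\<^sup>2)"
      by (simp add: q_def power_mult_distrib)
    moreover have "1 + - (2 * (q * s\<^sup>2)) \<le> exp (- (2 * (q * s\<^sup>2)))" by (rule exp_ge_add_one_self)
    moreover have "exp (- (2 * (q * s\<^sup>2))) = (exp (- q * s\<^sup>2))\<^sup>2" by (simp add: exp_double[symmetric])
    ultimately have "(cmod (\<Sum>x\<in>\<Lambda>. cis (s * x) * p x))\<^sup>2 \<le> (exp (- q * s\<^sup>2))\<^sup>2" by linarith
    then show ?thesis by (rule power2_le_imp_le) simp
  qed
  with q r show ?thesis by (rule that)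
qed

subsection \<open>Replication processes\<close>

text \<open>The later estimates use a replication process through these three facts. The contraction
  bound results from testing trace non-increase on rank-one operators.\<close>

lemma replication_Kraus:
  assumes "replication_process d N M P"
  shows "\<exists>(R::nat) \<kappa>.
    (\<forall>u\<in>carrier_vec (d ^ N). Re (mat_trace (P (ket_bra u))) = yield_norm (d ^ N) (d ^ M) R \<kappa> (($) u)) \<and>
    (\<forall>u\<in>carrier_vec (d ^ N). \<forall>w\<in>carrier_vec (d ^ M).
       Re ((P (ket_bra u) *\<^sub>v w) \<bullet>c w) = overlap (d ^ N) (d ^ M) R \<kappa> (($) w) (($) u)) \<and>
    (\<forall>u. yield_norm (d ^ N) (d ^ M) R \<kappa> u \<le> sqn (d ^ N) u)"
proof -
  define n where "n = d ^ N"
  define m where "m = d ^ M"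
  have CP: "completely_positive n m P" and TN: "trace_nonincreasing n P"
    using assms by (auto simp: replication_process_def n_def m_def)
  obtain R :: nat and \<kappa> where \<kappa>: "\<And>u a b. u \<in> carrier_vec n \<Longrightarrow> a < m \<Longrightarrow> b < m \<Longrightarrow>
      P (ket_bra u) $$ (a, b) = (\<Sum>l<R. app n (\<kappa> l) (($) u) a * cnj (app n (\<kappa> l) (($) u) b))"
    using Kraus_decomposition[OF CP] by blast
  have Pc: "P (ket_bra u) \<in> carrier_mat m m" if "u \<in> carrier_vec n" for u
  proof -
    have "ket_bra u \<in> carrier_mat n n" using that by (simp add: ket_bra_def)
    then show ?thesis using CP by (simp add: completely_positive_def linear_map_def)
  qed
  have tr: "mat_trace (P (ket_bra u)) = complex_of_real (yield_norm n m R \<kappa> (($) u))" if u: "u \<in> carrier_vec n" for u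
  proof -
    have "mat_trace (P (ket_bra u)) = (\<Sum>a<m. \<Sum>l<R. app n (\<kappa> l) (($) u) a * cnj (app n (\<kappa> l) (($) u) a))"
      using Pc[OF u] \<kappa>[OF u] by (simp add: mat_trace_def)
    also have "\<dots> = (\<Sum>l<R. \<Sum>a<m. app n (\<kappa> l) (($) u) a * cnj (app n (\<kappa> l) (($) u) a))" by (rule sum.swap)
    also have "\<dots> = (\<Sum>l<R. ip m (app n (\<kappa> l) (($) u)) (app n (\<kappa> l) (($) u)))" by (simp only: ip_def)
    also have "\<dots> = complex_of_real (yield_norm n m R \<kappa> (($) u))" by (simp add: ip_self yield_norm_def)
    finally show ?thesis .
  qed
  have ov: "(P (ket_bra u) *\<^sub>v w) \<bullet>c w = complex_of_real (overlap n m R \<kappa> (($) w) (($) u))"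
    if u: "u \<in> carrier_vec n" and w: "w \<in> carrier_vec m" for u w
  proof -
    let ?y = "\<lambda>l. app n (\<kappa> l) (($) u)"
    have "(P (ket_bra u) *\<^sub>v w) \<bullet>c w
        = (\<Sum>a<m. \<Sum>b<m. \<Sum>l<R. (?y l a * cnj (w $ a)) * cnj (?y l b * cnj (w $ b)))"
      unfolding cinner_mult_mat_vec[OF Pc[OF u] w w]
      by (intro sum.cong refl) (simp add: \<kappa>[OF u] sum_distrib_left sum_distrib_right mult_ac)
    also have "\<dots> = (\<Sum>a<m. \<Sum>l<R. \<Sum>b<m. (?y l a * cnj (w $ a)) * cnj (?y l b * cnj (w $ b)))"
      by (rule sum.cong[OF refl], rule sum.swap)
    also have "\<dots> = (\<Sum>l<R. \<Sum>a<m. \<Sum>b<m. (?y l a * cnj (w $ a)) * cnj (?y l b * cnj (w $ b)))"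
      by (rule sum.swap)
    also have "\<dots> = (\<Sum>l<R. ip m (?y l) (($) w) * cnj (ip m (?y l) (($) w)))"
      by (simp only: ip_def sum_product cnj_sum)
    also have "\<dots> = complex_of_real (overlap n m R \<kappa> (($) w) (($) u))"
      unfolding overlap_def of_real_sum complex_norm_square ..
    finally show ?thesis .
  qed
  have contr: "yield_norm n m R \<kappa> u \<le> sqn n u" for u
  proof -
    let ?u = "vec n u"
    have c: "?u \<in> carrier_vec n" by simp
    have "mat_trace (P (ket_bra ?u)) \<le> mat_trace (ket_bra ?u)"
      using TN pos_semidef_ket_bra[OF c] unfolding trace_nonincreasing_def by blast
    moreover have "mat_trace (ket_bra ?u) = complex_of_real (sqn n u)"
      unfolding ip_self[symmetric] by (simp add: mat_trace_def ket_bra_def ip_def)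
    moreover have "yield_norm n m R \<kappa> (($) ?u) = yield_norm n m R \<kappa> u"
      unfolding yield_norm_def by (intro sum.cong refl arg_cong[of _ _ "sqn m"] app_cong) simp
    ultimately show ?thesis by (simp add: tr less_eq_complex_def)
  qed
  show ?thesis
    by (intro exI[of _ R] exI[of _ \<kappa>]) (simp add: tr ov contr flip: n_def m_def)
qed

lemma clock_state_carrier:
  assumes "H \<in> carrier_mat d d"
  shows "clock_state H \<psi> t \<in> carrier_vec d"
  using assms by (intro carrier_vecI) (simp add: clock_state_def mat_exp_def)

text \<open>\<open>fidelity_bound\<close> is applied to tensor powers with window centre
  \<open>real N * \<mu>\<close> and target overlaps at most
  \<open>exp (- q * real M * h\<^sup>2)\<close>. Here \<open>\<theta>\<close> is the Chernoff
  parameter, and the moment bound of \<open>N\<close> copies is the \<open>N\<close>-th power of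
  that of one copy. The condition \<open>real K * h \<le> r\<close> keeps all time differences
  within the range of \<open>decay\<close>.\<close>

lemma fidelity_estimate:
  fixes \<Lambda> :: "real set" and B :: "real \<Rightarrow> nat \<Rightarrow> complex"
  assumes H: "H \<in> carrier_mat d d" and fin: "finite \<Lambda>"
    and orth: "\<And>x y. x \<in> \<Lambda> \<Longrightarrow> y \<in> \<Lambda> \<Longrightarrow> x \<noteq> y \<Longrightarrow> ip d (B x) (B y) = 0"
    and one: "(\<Sum>x\<in>\<Lambda>. sqn d (B x)) = 1"
    and clock: "\<And>t i. i < d \<Longrightarrow> clock_state H \<psi> t $ i = (\<Sum>x\<in>\<Lambda>. exp (- \<i> * t * x) * B x i)"
    and decay: "\<And>s. \<bar>s\<bar> \<le> r \<Longrightarrow> cmod (\<Sum>x\<in>\<Lambda>. cis (s * x) * sqn d (B x)) \<le> exp (- q * s\<^sup>2)"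
    and q: "0 < q"
    and b: "\<And>x. x \<in> \<Lambda> \<Longrightarrow> \<bar>x - (\<Sum>x\<in>\<Lambda>. sqn d (B x) * x)\<bar> \<le> b"
    and P: "replication_process d N M P" and p0: "0 < p0" "p0 \<le> success_prob H \<psi> N P"
    and K: "0 < K" and h: "0 \<le> h" "real K * h \<le> r" and L: "0 \<le> L" and \<theta>: "0 \<le> \<theta>" "\<theta> * b \<le> 1"
  shows "0 \<le> fidelity H \<psi> N M P"
    and "fidelity H \<psi> N M P \<le> 4 / real K + 4 * exp (- q * real M * h\<^sup>2) + 4 * (real K * h * L)\<^sup>2
      + 4 * exp (real N * \<theta>\<^sup>2 * b\<^sup>2 - \<theta> * L) / p0"
proof -
  \<comment> \<open>This is the clock state continued to complex time: \<open>z = - \<i> * t\<close>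
    is the real time \<open>t\<close>, and a real part of \<open>z\<close> reweights the
    energies.\<close>
  define v where "v z = vec d (\<lambda>i. \<Sum>x\<in>\<Lambda>. exp (z * complex_of_real x) * B x i)" for z
  define p where "p x = sqn d (B x)" for x
  define \<mu> where "\<mu> = (\<Sum>x\<in>\<Lambda>. p x * x)"
  define g where "g y = (\<Sum>x\<in>\<Lambda>. exp (y * x) * p x)" for y :: real
  define f where "f t = ($) (tensor_pow_vec (clock_state H \<psi> t) N)" for t
  define \<phi> where "\<phi> t = ($) (tensor_pow_vec (clock_state H \<psi> t) M)" for t
  have vc: "v z \<in> carrier_vec d" for z by (simp add: v_def)
  have vi: "v z $ i = (\<Sum>x\<in>\<Lambda>. exp (z * complex_of_real x) * B x i)" if "i < d" for z i
    using that by (simp add: v_def)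
  have cs: "clock_state H \<psi> t = v (- \<i> * t)" for t
    using clock_state_carrier[OF H, of \<psi> t] by (intro eq_vecI) (auto simp: clock v_def)
  have ip_v: "ip d (($) (v z)) (($) (v w)) = (\<Sum>x\<in>\<Lambda>. exp ((z + cnj w) * complex_of_real x) * p x)" for z w
    unfolding p_def using ip_exp_sum[where z = z and w = w, OF fin orth]
    by (subst ip_cong[where u' = "\<lambda>i. \<Sum>x\<in>\<Lambda>. exp (z * complex_of_real x) * B x i"
          and v' = "\<lambda>i. \<Sum>x\<in>\<Lambda>. exp (w * complex_of_real x) * B x i"]) (simp_all add: vi)
  have sqn_v: "sqn d (($) (v z)) = g (2 * Re z)" for z
  proof -
    have "z + cnj z = complex_of_real (2 * Re z)" by (simp add: complex_eq_iff)
    then have "complex_of_real (sqn d (($) (v z))) = (\<Sum>x\<in>\<Lambda>. exp (complex_of_real (2 * Re z) * complex_of_real x) * p x)"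
      unfolding ip_self[symmetric] ip_v by simp
    also have "\<dots> = complex_of_real (g (2 * Re z))"
      unfolding g_def of_real_sum of_real_mult[symmetric] exp_of_real ..
    finally show ?thesis by (simp only: of_real_eq_iff)
  qed
  have ip_cs: "ip d (($) (clock_state H \<psi> s)) (($) (clock_state H \<psi> t)) = (\<Sum>x\<in>\<Lambda>. cis ((t - s) * x) * p x)" for s t
    unfolding cs ip_v by (intro sum.cong refl) (simp add: cis_conv_exp algebra_simps)
  have g0: "g 0 = 1" using one by (simp add: g_def p_def)
  have unit: "sqn (d ^ M) (\<phi> t) = 1" for t
    unfolding \<phi>_def cs sqn_tensor_pow_vec[OF vc] sqn_v by (simp add: g0)
  have ortho: "cmod (ip (d ^ M) (\<phi> (t + real k * h)) (\<phi> (t + real l * h))) \<le> exp (- q * real M * h\<^sup>2)"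
    if kl: "k < K" "l < K" "k \<noteq> l" for t k l
  proof -
    let ?s = "(t + real l * h) - (t + real k * h)"
    have s: "?s = (real l - real k) * h" by (simp add: algebra_simps)
    have "\<bar>real l - real k\<bar> \<le> real K" and one: "1 \<le> \<bar>real l - real k\<bar>" using kl by linarith+
    then have "\<bar>?s\<bar> \<le> real K * h" unfolding s abs_mult using h by (intro mult_mono) auto
    then have "cmod (\<Sum>x\<in>\<Lambda>. cis (?s * x) * p x) \<le> exp (- q * ?s\<^sup>2)"
      using h unfolding p_def by (intro decay) linarith
    then have "cmod (ip (d ^ M) (\<phi> (t + real k * h)) (\<phi> (t + real l * h))) \<le> exp (- q * ?s\<^sup>2) ^ M"
      unfolding \<phi>_def ip_tensor_pow_vec[OF clock_state_carrier[OF H] clock_state_carrier[OF H]] ip_cs norm_power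
      by (intro power_mono) auto
    also have "\<dots> = exp (- q * real M * ?s\<^sup>2)" by (simp add: exp_of_nat_mult[symmetric] mult_ac)
    also have "\<dots> \<le> exp (- q * real M * h\<^sup>2)"
    proof -
      have "1 * h \<le> \<bar>real l - real k\<bar> * h" using one h by (intro mult_right_mono) auto
      then have "h\<^sup>2 \<le> (\<bar>real l - real k\<bar> * h)\<^sup>2" using h by (intro power_mono) auto
      then have "h\<^sup>2 \<le> ?s\<^sup>2" unfolding s by (simp add: power_mult_distrib)
      then have "q * real M * h\<^sup>2 \<le> q * real M * ?s\<^sup>2" using q by (intro mult_left_mono) auto
      then show ?thesis by simp
    qed
    finally show ?thesis .
  qed
  obtain S A where S: "finite S" and A: "\<And>z i. i < d ^ N \<Longrightarrow>
      tensor_pow_vec (v z) N $ i = (\<Sum>E\<in>S. exp (z * complex_of_real E) * A E i)"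
    using tensor_pow_exp_sum[OF fin vc vi, of N] by blast
  have f: "f t i = (\<Sum>E\<in>S. cis (- (t * E)) * A E i)" if "i < d ^ N" for t i
    unfolding f_def cs A[OF that] by (simp add: cis_conv_exp mult_ac)
  have mgf: "(\<Sum>E\<in>S. exp (\<tau> * E) * sqn (d ^ N) (A E)) = g \<tau> ^ N" for \<tau>
    by (rule energy_mgf[where g = "\<lambda>y. g y ^ N" and f = "\<lambda>z. ($) (tensor_pow_vec (v z) N)"])
      (simp_all add: S A sqn_tensor_pow_vec[OF vc] sqn_v)
  define \<beta> where "\<beta> = 2 * exp (- \<theta> * L) * exp (\<theta>\<^sup>2 * b\<^sup>2) ^ N"
  have tail: "(\<Sum>E\<in>{E\<in>S. \<bar>E - real N * \<mu>\<bar> > L}. sqn (d ^ N) (A E)) \<le> \<beta>"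
    unfolding \<beta>_def
  proof (rule Chernoff_tail[OF S])
    fix \<tau> :: real assume \<tau>: "\<bar>\<tau>\<bar> = \<theta>"
    have "exp (- \<tau> * (real N * \<mu>)) * (\<Sum>E\<in>S. exp (\<tau> * E) * sqn (d ^ N) (A E)) = (exp (- \<tau> * \<mu>) * g \<tau>) ^ N"
      unfolding mgf by (simp add: power_mult_distrib exp_of_nat_mult[symmetric] mult_ac)
    also have "\<dots> \<le> exp (\<tau>\<^sup>2 * b\<^sup>2) ^ N"
    proof (intro power_mono)
      show "exp (- \<tau> * \<mu>) * g \<tau> \<le> exp (\<tau>\<^sup>2 * b\<^sup>2)"
        unfolding g_def
        by (rule centred_mgf_bound) (use one b \<theta> \<tau> in \<open>auto simp: p_def \<mu>_def\<close>)
      show "0 \<le> exp (- \<tau> * \<mu>) * g \<tau>"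
        by (auto simp: g_def p_def intro!: mult_nonneg_nonneg sum_nonneg)
    qed
    also have "\<tau>\<^sup>2 = \<theta>\<^sup>2" using \<tau> by (metis power2_abs)
    finally show "exp (- \<tau> * (real N * \<mu>)) * (\<Sum>E\<in>S. exp (\<tau> * E) * sqn (d ^ N) (A E)) \<le> exp (\<theta>\<^sup>2 * b\<^sup>2) ^ N" .
  qed (use \<theta> in auto)
  obtain R :: nat and \<kappa> where
    tr: "\<And>u. u \<in> carrier_vec (d ^ N) \<Longrightarrow>
       Re (mat_trace (P (ket_bra u))) = yield_norm (d ^ N) (d ^ M) R \<kappa> (($) u)"
    and ov: "\<And>u w. u \<in> carrier_vec (d ^ N) \<Longrightarrow> w \<in> carrier_vec (d ^ M) \<Longrightarrow>
       Re ((P (ket_bra u) *\<^sub>v w) \<bullet>c w) = overlap (d ^ N) (d ^ M) R \<kappa> (($) w) (($) u)"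
    and contr: "\<And>u. yield_norm (d ^ N) (d ^ M) R \<kappa> u \<le> sqn (d ^ N) u"
    using replication_Kraus[OF P] by blast
  let ?Y = "yield_norm (d ^ N) (d ^ M) R \<kappa>" and ?O = "overlap (d ^ N) (d ^ M) R \<kappa>"
  have succ: "success_prob_at H \<psi> N P t = ?Y (f t)" for t
    unfolding success_prob_at_def tensor_pow_mat_ket_bra[OF clock_state_carrier[OF H]]
    by (subst tr) (simp_all add: f_def tensor_pow_vec_carrier[OF clock_state_carrier[OF H]])
  have Fdef: "fidelity H \<psi> N M P = (INF t\<in>{t. ?Y (f t) \<noteq> 0}. ?O (\<phi> t) (f t) / ?Y (f t))"
    unfolding fidelity_def succ tensor_pow_mat_ket_bra[OF clock_state_carrier[OF H]]
    by (simp add: ov tensor_pow_vec_carrier[OF clock_state_carrier[OF H]] f_def \<phi>_def)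
  have "success_prob H \<psi> N P \<le> ?Y (f t)" for t
    unfolding success_prob_def succ
    by (rule cINF_lower) (auto intro!: bdd_belowI[of _ 0] simp: yield_norm_nonneg)
  then have Y: "p0 \<le> ?Y (f t)" for t using p0(2) by (rule order_trans[rotated])
  have Ypos: "0 < ?Y (f t)" for t using Y[of t] p0(1) by linarith
  \<comment> \<open>The success probability is positive at every time, so the infimum in
    \<open>fidelity\<close> runs over all of them.\<close>
  have all: "{t. ?Y (f t) \<noteq> 0} = UNIV" using Ypos by (auto simp: less_le)
  have nn: "0 \<le> ?O (\<phi> t) (f t) / ?Y (f t)" for t
    by (simp add: overlap_def yield_norm_nonneg sum_nonneg)
  show "0 \<le> fidelity H \<psi> N M P" unfolding Fdef all by (rule cINF_greatest) (auto simp: nn)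
  have "fidelity H \<psi> N M P \<le> ?O (\<phi> t) (f t) / ?Y (f t)" for t
    unfolding Fdef all by (rule cINF_lower) (auto intro!: bdd_belowI[of _ 0] simp: nn)
  then have fid: "fidelity H \<psi> N M P * ?Y (f t) \<le> ?O (\<phi> t) (f t)" for t
    by (simp only: pos_le_divide_eq[OF Ypos])
  have "fidelity H \<psi> N M P \<le> 4 / real K + 4 * exp (- q * real M * h\<^sup>2) + 4 * (real K * h * L)\<^sup>2 + 2 * \<beta> / p0"
    by (rule fidelity_bound[OF S K h(1) L _ p0(1) contr f unit ortho fid Y tail]) auto
  also have "2 * \<beta> = 4 * exp (real N * \<theta>\<^sup>2 * b\<^sup>2 - \<theta> * L)"
  proof -
    have "\<beta> = 2 * (exp (- \<theta> * L) * exp (real N * (\<theta>\<^sup>2 * b\<^sup>2)))" by (simp add: \<beta>_def exp_of_nat_mult)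
    also have "exp (- \<theta> * L) * exp (real N * (\<theta>\<^sup>2 * b\<^sup>2)) = exp (real N * \<theta>\<^sup>2 * b\<^sup>2 - \<theta> * L)"
      unfolding exp_add[symmetric] by (simp add: algebra_simps)
    finally show ?thesis by simp
  qed
  finally show "fidelity H \<psi> N M P \<le> 4 / real K + 4 * exp (- q * real M * h\<^sup>2) + 4 * (real K * h * L)\<^sup>2
      + 4 * exp (real N * \<theta>\<^sup>2 * b\<^sup>2 - \<theta> * L) / p0" .
qed

section \<open>Choice of the parameters and the limit\<close>

lemma exp_powr_tendsto_0:
  fixes a \<alpha> :: real
  assumes "0 < a" "0 < \<alpha>"
  shows "(\<lambda>N. exp (- a * real N powr \<alpha>)) \<longlonglongrightarrow> 0"
  using assms by real_asymp

lemma exp_powr_diff_tendsto_0: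
  fixes a \<alpha> \<beta> :: real
  assumes "0 < a" "0 \<le> \<alpha>" "\<alpha> < \<beta>"
  shows "(\<lambda>N. exp (real N powr \<alpha> - a * real N powr \<beta>)) \<longlonglongrightarrow> 0"
  using assms by real_asymp

theorem theorem1:
  fixes d :: nat and H :: "complex mat" and \<psi> :: "complex vec"
    and \<epsilon> c \<delta> :: real and M :: "nat \<Rightarrow> nat"
    and P :: "nat \<Rightarrow> complex mat \<Rightarrow> complex mat"
  assumes "H \<in> carrier_mat d d" and "mat_adjoint H = H"
    and "\<psi> \<in> carrier_vec d" and "\<psi> \<bullet>c \<psi> = 1"
    and "\<not> (\<exists>E. eigenvector H \<psi> E)"
    and "0 < \<epsilon>" and "\<epsilon> \<le> 1" and "0 < c"
    and "\<And>N. 1 \<le> N \<Longrightarrow> replication_process d N (M N) (P N)"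
    and "\<And>N. 1 \<le> N \<Longrightarrow> c * real N powr (1 + \<epsilon>) \<le> real (M N)"
    and "\<delta> < \<epsilon>"
    and "0 < liminf (\<lambda>N. ereal (success_prob H \<psi> N (P N) / exp (- (real N powr \<delta>))))"
  shows "(\<lambda>N. fidelity H \<psi> N (M N) (P N)) \<longlonglongrightarrow> 0"
proof -
  note H = assms(1) and adj = assms(2) and \<psi> = assms(3) and unit = assms(4) and ne = assms(5)
    and \<epsilon> = assms(6,7) and c = assms(8) and P = assms(9) and M = assms(10) and \<delta> = assms(11) and lim = assms(12)
  obtain \<Lambda> :: "real set" and B :: "real \<Rightarrow> nat \<Rightarrow> complex" where fin: "finite \<Lambda>"
    and two: "\<exists>x\<in>\<Lambda>. \<exists>y\<in>\<Lambda>. x \<noteq> y" and pos: "\<And>x. x \<in> \<Lambda> \<Longrightarrow> 0 < sqn d (B x)"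
    and orth: "\<And>x y. x \<in> \<Lambda> \<Longrightarrow> y \<in> \<Lambda> \<Longrightarrow> x \<noteq> y \<Longrightarrow> ip d (B x) (B y) = 0"
    and one: "(\<Sum>x\<in>\<Lambda>. sqn d (B x)) = 1"
    and clock: "\<And>t i. i < d \<Longrightarrow> clock_state H \<psi> t $ i = (\<Sum>x\<in>\<Lambda>. exp (- \<i> * t * x) * B x i)"
    using clock_spectral[OF H adj \<psi> unit ne] by blast
  obtain q r where q: "0 < q" and r: "0 < r" and decay: "\<And>s. \<bar>s\<bar> \<le> r \<Longrightarrow>
      cmod (\<Sum>x\<in>\<Lambda>. cis (s * x) * sqn d (B x)) \<le> exp (- q * s\<^sup>2)"
    using char_fun_decay[OF fin pos one two] by blast
  define \<mu> where "\<mu> = (\<Sum>x\<in>\<Lambda>. sqn d (B x) * x)"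
  define b where "b = Max ((\<lambda>x. \<bar>x - \<mu>\<bar>) ` \<Lambda>)"
  have b: "\<bar>x - \<mu>\<bar> \<le> b" if "x \<in> \<Lambda>" for x unfolding b_def using fin that by (intro Max_ge) auto
  have b0: "0 \<le> b" using two b abs_ge_zero order_trans by blast
  \<comment> \<open>With this constant the quadratic term of the Chernoff exponent is at most half
    the linear one (\<open>\<gamma> * b\<^sup>2 \<le> 1 / 2\<close>), and the smallness condition of
    \<open>centred_mgf_bound\<close> holds (\<open>\<gamma> * b \<le> 1\<close>).\<close>
  define \<gamma> where "\<gamma> = 1 / (2 * (1 + b\<^sup>2))"
  have g1: "0 < 1 + b\<^sup>2" by (simp add: add_pos_nonneg)
  have \<gamma>: "0 < \<gamma>" "\<gamma> * b\<^sup>2 \<le> 1 / 2" "\<gamma> * b \<le> 1"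
  proof -
    show \<gamma>0: "0 < \<gamma>" using g1 by (simp add: \<gamma>_def)
    have eq: "\<gamma> * (2 * (1 + b\<^sup>2)) = 1" using g1 unfolding \<gamma>_def by (intro nonzero_eq_divide_eq[THEN iffD1]) auto
    have "\<gamma> * (2 * b\<^sup>2) \<le> \<gamma> * (2 * (1 + b\<^sup>2))" using \<gamma>0 by (intro mult_left_mono) auto
    then show "\<gamma> * b\<^sup>2 \<le> 1 / 2" unfolding eq by simp
    have "2 * b \<le> 1 + b\<^sup>2" using zero_le_power2[of "b - 1"] by (simp add: power2_diff)
    moreover have "b \<le> 2 * b" "1 + b\<^sup>2 \<le> 2 * (1 + b\<^sup>2)" using b0 g1 by simp_all
    ultimately have "b \<le> 2 * (1 + b\<^sup>2)" by (meson order_trans)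
    then have "\<gamma> * b \<le> \<gamma> * (2 * (1 + b\<^sup>2))" using \<gamma>0 by (intro mult_left_mono) auto
    then show "\<gamma> * b \<le> 1" unfolding eq .
  qed
  \<comment> \<open>A negative \<open>\<delta>\<close> is raised to 0, so that
    \<open>\<delta>'\<close> lies strictly between 0 and \<open>\<epsilon>\<close>; for
    \<open>N \<ge> 1\<close> this only weakens the lower bound on the success probability.\<close>
  define \<delta>0 where "\<delta>0 = max \<delta> 0"
  define \<delta>' where "\<delta>' = (\<delta>0 + \<epsilon>) / 2"
  have d0: "0 \<le> \<delta>0" "\<delta> \<le> \<delta>0" "\<delta>0 < \<delta>'" "\<delta>' < \<epsilon>" "\<delta>' < 1" using \<epsilon> \<delta> by (auto simp: \<delta>0_def \<delta>'_def)
  \<comment> \<open>The exponents are matched so that \<open>real N * (\<theta> N)\<^sup>2\<close>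
    and \<open>\<theta> N * L N\<close> both have order
    \<open>real N powr \<delta>'\<close>.\<close>
  define L where "L N = real N powr ((1 + \<delta>') / 2)" for N
  define \<theta> where "\<theta> N = \<gamma> * real N powr ((\<delta>' - 1) / 2)" for N
  \<comment> \<open>A positive number below the lower limit turns the hypothesis into an eventual
    bound on the success probability.\<close>
  obtain \<eta> where \<eta>: "0 < \<eta>" "ereal \<eta> < liminf (\<lambda>N. ereal (success_prob H \<psi> N (P N) / exp (- (real N powr \<delta>))))"
    using ereal_dense2[OF lim] by auto
  have success: "eventually (\<lambda>N. \<eta> * exp (- (real N powr \<delta>)) \<le> success_prob H \<psi> N (P N)) sequentially"
    using less_LiminfD[OF \<eta>(2)] by eventually_elim (simp add: field_simps)
  have exponent: "real N * (\<theta> N)\<^sup>2 * b\<^sup>2 - \<theta> N * L N \<le> - (\<gamma> / 2) * real N powr \<delta>'" if "1 \<le> N" for N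
  proof -
    have "real N * (real N powr ((\<delta>' - 1) / 2))\<^sup>2 = real N powr 1 * (real N powr ((\<delta>' - 1) / 2) * real N powr ((\<delta>' - 1) / 2))"
      using that by (simp add: power2_eq_square)
    also have "\<dots> = real N powr \<delta>'" unfolding powr_add[symmetric] by (simp add: field_simps)
    finally have 1: "real N * (\<theta> N)\<^sup>2 = \<gamma>\<^sup>2 * real N powr \<delta>'" by (simp add: \<theta>_def power_mult_distrib mult_ac)
    have 2: "\<theta> N * L N = \<gamma> * real N powr \<delta>'"
      unfolding \<theta>_def L_def mult.assoc powr_add[symmetric] by (simp add: field_simps)
    have "\<gamma> * (\<gamma> * b\<^sup>2) * real N powr \<delta>' \<le> \<gamma> * (1 / 2) * real N powr \<delta>'"
      using \<gamma> by (intro mult_right_mono mult_left_mono) auto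
    then show ?thesis unfolding 1 2 by (simp add: power2_eq_square mult_ac)
  qed
  have \<theta>b: "\<theta> N * b \<le> 1" if "1 \<le> N" for N
  proof -
    have "real N powr ((\<delta>' - 1) / 2) \<le> real N powr 0" using that d0 by (intro powr_mono) auto
    then have "\<theta> N \<le> \<gamma> * 1" unfolding \<theta>_def using \<gamma> that by (intro mult_left_mono) auto
    then have "\<theta> N * b \<le> \<gamma> * 1 * b" using b0 by (rule mult_right_mono)
    then show ?thesis using \<gamma> by simp
  qed
  have ev1: "eventually (\<lambda>N::nat. 1 \<le> N) sequentially" by (rule eventually_ge_at_top)
  \<comment> \<open>The time step is \<open>h = \<rho> / L N\<close>. Then
    \<open>real K * h * L N\<close> is the constant \<open>real K * \<rho>\<close>, while
    \<open>real (M N) * h\<^sup>2\<close> is at least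
    \<open>c * \<rho>\<^sup>2 * real N powr (\<epsilon> - \<delta>')\<close>.\<close>
  have estimate: "eventually (\<lambda>N. 0 \<le> fidelity H \<psi> N (M N) (P N) \<and>
      fidelity H \<psi> N (M N) (P N) \<le> 4 / real K + 4 * (real K * \<rho>)\<^sup>2
        + 4 * exp (- (q * c * \<rho>\<^sup>2) * real N powr (\<epsilon> - \<delta>'))
        + 4 / \<eta> * exp (real N powr \<delta>0 - \<gamma> / 2 * real N powr \<delta>')) sequentially"
    if K: "0 < K" and \<rho>: "0 < \<rho>" for K :: nat and \<rho> :: real
  proof -
    have "((\<lambda>N. real K * \<rho> / L N) \<longlongrightarrow> 0) sequentially"
      unfolding L_def using d0 K \<rho> by real_asymp
    then have "eventually (\<lambda>N. real K * \<rho> / L N < r) sequentially" using r by (rule order_tendstoD)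
    with success ev1 show ?thesis
    proof eventually_elim
      case (elim N)
      let ?p0 = "\<eta> * exp (- (real N powr \<delta>))"
      have Lpos: "0 < L N" using elim by (simp add: L_def)
      have p0: "0 < ?p0" using \<eta> by simp
      have h: "0 \<le> \<rho> / L N" "real K * (\<rho> / L N) \<le> r" using \<rho> Lpos elim by auto
      have \<theta>0: "0 \<le> \<theta> N" using \<gamma> by (simp add: \<theta>_def)
      note est = fidelity_estimate[OF H fin orth one clock decay q b[unfolded \<mu>_def] P[OF \<open>1 \<le> N\<close>]
          p0 elim(1) K h less_imp_le[OF Lpos] \<theta>0 \<theta>b[OF \<open>1 \<le> N\<close>]]
      have e1: "(real K * (\<rho> / L N) * L N)\<^sup>2 = (real K * \<rho>)\<^sup>2" using Lpos by simp
      have e2: "exp (- q * real (M N) * (\<rho> / L N)\<^sup>2) \<le> exp (- (q * c * \<rho>\<^sup>2) * real N powr (\<epsilon> - \<delta>'))"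
      proof -
        have "(L N)\<^sup>2 = real N powr (1 + \<delta>')"
          unfolding L_def power2_eq_square powr_add[symmetric] by simp
        then have "real N powr (1 + \<epsilon>) * (\<rho> / L N)\<^sup>2 = \<rho>\<^sup>2 * (real N powr (1 + \<epsilon>) / real N powr (1 + \<delta>'))"
          by (simp add: power_divide)
        also have "\<dots> = \<rho>\<^sup>2 * real N powr (\<epsilon> - \<delta>')" unfolding powr_diff[symmetric] by simp
        finally have "q * c * \<rho>\<^sup>2 * real N powr (\<epsilon> - \<delta>') = q * (c * real N powr (1 + \<epsilon>)) * (\<rho> / L N)\<^sup>2"
          by simp
        also have "\<dots> \<le> q * real (M N) * (\<rho> / L N)\<^sup>2"
          using M[OF \<open>1 \<le> N\<close>] q by (intro mult_right_mono mult_left_mono) auto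
        finally show ?thesis by simp
      qed
      have e3: "4 * exp (real N * (\<theta> N)\<^sup>2 * b\<^sup>2 - \<theta> N * L N) / ?p0
          \<le> 4 / \<eta> * exp (real N powr \<delta>0 - \<gamma> / 2 * real N powr \<delta>')"
      proof -
        have "4 * exp (real N * (\<theta> N)\<^sup>2 * b\<^sup>2 - \<theta> N * L N) / ?p0
            = 4 / \<eta> * exp (real N * (\<theta> N)\<^sup>2 * b\<^sup>2 - \<theta> N * L N + real N powr \<delta>)"
          unfolding exp_add by (simp add: exp_minus divide_inverse)
        also have "\<dots> \<le> 4 / \<eta> * exp (- (\<gamma> / 2) * real N powr \<delta>' + real N powr \<delta>0)"
          using exponent[OF \<open>1 \<le> N\<close>] \<eta> powr_mono[OF d0(2), of "real N"] elim
          by (intro mult_left_mono) (simp_all add: add_mono)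
        finally show ?thesis by simp
      qed
      show ?case using est e2 e3 unfolding e1 by linarith
    qed
  qed
  show ?thesis
  proof (rule LIMSEQ_I)
    fix e :: real assume e: "0 < e"
    \<comment> \<open>\<open>K\<close> and then \<open>\<rho>\<close> are fixed before
      \<open>N\<close> grows. The term \<open>4 / real K\<close> is below \<open>e / 4\<close> and
      \<open>4 * (real K * \<rho>)\<^sup>2\<close> equals \<open>e / 16\<close>, together less than
      \<open>e / 2\<close>; each of the two terms vanishing with \<open>N\<close> may use
      \<open>e / 4\<close>.\<close>
    obtain K :: nat where K: "16 / e < real K" using reals_Archimedean2 by blast
    have "0 < 16 / e" using e by simp
    with K have K0: "0 < K" using of_nat_0_less_iff[where 'a = real] less_trans by blast
    define \<rho> where "\<rho> = sqrt e / (8 * real K)"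
    have \<rho>: "0 < \<rho>" using e K0 by (simp add: \<rho>_def)
    have "(real K * \<rho>)\<^sup>2 = e / 64" using K0 e by (simp add: \<rho>_def power_divide)
    moreover have "4 / real K < e / 4" using K K0 e by (simp add: field_simps)
    ultimately have small: "4 / real K + 4 * (real K * \<rho>)\<^sup>2 < e / 2" using e by linarith
    have a: "0 < q * c * \<rho>\<^sup>2" using q c \<rho> by simp
    have "(\<lambda>N. 4 * exp (- (q * c * \<rho>\<^sup>2) * real N powr (\<epsilon> - \<delta>'))) \<longlonglongrightarrow> 4 * 0"
      using a d0(4) by (intro tendsto_mult_left exp_powr_tendsto_0) auto
    then have l1: "eventually (\<lambda>N. 4 * exp (- (q * c * \<rho>\<^sup>2) * real N powr (\<epsilon> - \<delta>')) < e / 4) sequentially"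
      by (rule order_tendstoD) (use e in simp)
    have "(\<lambda>N. 4 / \<eta> * exp (real N powr \<delta>0 - \<gamma> / 2 * real N powr \<delta>')) \<longlonglongrightarrow> 4 / \<eta> * 0"
      using \<gamma> d0 by (intro tendsto_mult_left exp_powr_diff_tendsto_0) auto
    then have l2: "eventually (\<lambda>N. 4 / \<eta> * exp (real N powr \<delta>0 - \<gamma> / 2 * real N powr \<delta>') < e / 4) sequentially"
      by (rule order_tendstoD) (use e in simp)
    have "eventually (\<lambda>N. norm (fidelity H \<psi> N (M N) (P N) - 0) < e) sequentially"
      using estimate[OF K0 \<rho>] l1 l2
    proof eventually_elim
      case (elim N)
      then show ?case using small by simp
    qed
    then show "\<exists>n0. \<forall>N\<ge>n0. norm (fidelity H \<psi> N (M N) (P N) - 0) < e"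
      by (simp only: eventually_sequentially)
  qed
qed

end
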